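(* Let $p$ be a prime, let $F$ be a finite extension of $\mathbb{Q}_p$ with residue degree $f$, ring of integers $\mathcal{O}_F$ and valuation $v_F$, and let $d$ be a positive integer with $p \mid d$. Let $\phi(X) = \sum_{i=0}^d a_i X^i \in \mathcal{O}_F[X]$ be a polynomial such that $v_F(a_d) = 0$ and $v_F(a_i) > 0$ for every $i$ with $p \nmid i$. Then $\phi$ has at most $p^f$ periodic points in $F$.
   Context: Write $\phi^n$ for the $n$-fold composition of $\phi$ with itself. A periodic point of $\phi$ in $F$ is an $x \in F$ with $\phi^n(x) = x$ for some positive integer $n$. The residue degree $f$ is the degree of the residue field of $F$ over $\mathbb{F}_p$. *)

theory Defs
  imports
    "HOL-Library.Extended_Real"
    "HOL-Computational_Algebra.Primes"
    "HOL-Algebra.QuotRing"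
    "HOL-Algebra.Embedded_Algebras"
    "HOL-Algebra.Generated_Fields"
    "HOL-Algebra.Polynomials"
begin

section \<open>The field of p-adic numbers\<close>

definition rat_pval :: "nat \<Rightarrow> rat \<Rightarrow> ereal" where
  "rat_pval p q =
     (if q = 0 then \<infinity>
      else ereal (real (multiplicity (int p) (fst (quotient_of q)))
                  - real (multiplicity (int p) (snd (quotient_of q)))))"

definition padic_cauchy :: "nat \<Rightarrow> (nat \<Rightarrow> rat) \<Rightarrow> bool" where
  "padic_cauchy p s \<longleftrightarrow>
     (\<forall>C::real. \<exists>N. \<forall>m\<ge>N. \<forall>n\<ge>N. rat_pval p (s m - s n) \<ge> ereal C)"

definition padic_null :: "nat \<Rightarrow> (nat \<Rightarrow> rat) set" where
  "padic_null p = {s. (\<lambda>n. rat_pval p (s n)) \<longlonglongrightarrow> \<infinity>}"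

definition padic_cauchy_ring :: "nat \<Rightarrow> (nat \<Rightarrow> rat) ring" where
  "padic_cauchy_ring p =
     \<lparr>carrier = {s. padic_cauchy p s},
      monoid.mult = (\<lambda>s t n. s n * t n), one = (\<lambda>n. 1),
      zero = (\<lambda>n. 0), add = (\<lambda>s t n. s n + t n)\<rparr>"

text \<open>
  The completion of the rationals with respect to the p-adic absolute value: p-adic Cauchy
  sequences modulo p-adic null sequences.
\<close>

definition Qp :: "nat \<Rightarrow> (nat \<Rightarrow> rat) set ring" where
  "Qp p = padic_cauchy_ring p Quot padic_null p"

text \<open>
  The continuous extension of the p-adic valuation from the rationals to the completion.
  Along a Cauchy sequence the valuations converge in \<^typ>\<open>ereal\<close>, to \<open>\<infinity>\<close> exactly for null
  sequences, and the limit depends only on the class of the sequence.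
\<close>

definition Qp_val :: "nat \<Rightarrow> (nat \<Rightarrow> rat) set \<Rightarrow> ereal" where
  "Qp_val p c = (THE l. \<forall>s\<in>c. (\<lambda>n. rat_pval p (s n)) \<longlonglongrightarrow> l)"


section \<open>Finite extensions of the p-adic numbers\<close>

text \<open>An extension of \<open>Qp p\<close> is a field together with an embedding \<open>\<iota>\<close> of \<open>Qp p\<close> into it.\<close>

definition finite_Qp_extension ::
  "nat \<Rightarrow> ('a, 'b) ring_scheme \<Rightarrow> ((nat \<Rightarrow> rat) set \<Rightarrow> 'a) \<Rightarrow> bool" where
  "finite_Qp_extension p F \<iota> \<longleftrightarrow>
     field F \<and> \<iota> \<in> ring_hom (Qp p) F \<and>
     ring.finite_dimension F (\<iota> ` carrier (Qp p)) (carrier F)"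

text \<open>
  The valuation of \<open>F\<close> extends the p-adic one. The factor \<open>e\<close> leaves the normalisation open:
  \<open>e = 1\<close> gives the valuation with \<open>v p = 1\<close>, and \<open>e\<close> the ramification index gives the one with
  value group the integers. Up to this factor \<open>v\<close> is uniquely determined on \<open>F\<close>.
\<close>

definition Qp_extension_valuation ::
  "nat \<Rightarrow> ('a, 'b) ring_scheme \<Rightarrow> ((nat \<Rightarrow> rat) set \<Rightarrow> 'a) \<Rightarrow> ('a \<Rightarrow> ereal) \<Rightarrow> bool" where
  "Qp_extension_valuation p F \<iota> v \<longleftrightarrow>
     (\<forall>x\<in>carrier F. v x \<noteq> - \<infinity>) \<and>
     (\<forall>x\<in>carrier F. v x = \<infinity> \<longleftrightarrow> x = \<zero>\<^bsub>F\<^esub>) \<and>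
     (\<forall>x\<in>carrier F. \<forall>y\<in>carrier F. v (x \<otimes>\<^bsub>F\<^esub> y) = v x + v y) \<and>
     (\<forall>x\<in>carrier F. \<forall>y\<in>carrier F. v (x \<oplus>\<^bsub>F\<^esub> y) \<ge> min (v x) (v y)) \<and>
     (\<exists>e::real. e > 0 \<and> (\<forall>x\<in>carrier (Qp p). v (\<iota> x) = ereal e * Qp_val p x))"

definition integer_ring :: "('a, 'b) ring_scheme \<Rightarrow> ('a \<Rightarrow> ereal) \<Rightarrow> 'a set" where
  "integer_ring F v = {x \<in> carrier F. v x \<ge> 0}"

definition max_ideal :: "('a, 'b) ring_scheme \<Rightarrow> ('a \<Rightarrow> ereal) \<Rightarrow> 'a set" where
  "max_ideal F v = {x \<in> carrier F. v x > 0}"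

definition residue_field :: "('a, 'b) ring_scheme \<Rightarrow> ('a \<Rightarrow> ereal) \<Rightarrow> 'a set ring" where
  "residue_field F v = (F\<lparr>carrier := integer_ring F v\<rparr>) Quot (max_ideal F v)"

text \<open>
  The prime field with \<open>p\<close> elements sits in the residue field as the subfield generated by the
  empty set.
\<close>

definition residue_degree :: "('a, 'b) ring_scheme \<Rightarrow> ('a \<Rightarrow> ereal) \<Rightarrow> nat" where
  "residue_degree F v =
     ring.dim (residue_field F v) (generate_field (residue_field F v) {})
       (carrier (residue_field F v))"


section \<open>Periodic points\<close>

definition periodic_points :: "('a \<Rightarrow> 'a) \<Rightarrow> 'a set \<Rightarrow> 'a set" where
  "periodic_points g S = {x \<in> S. \<exists>n>0. (g ^^ n) x = x}"

end

theory Submission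
  imports Defs
begin

text \<open>
  Write \<open>\<O>\<close> for the ring of integers of \<open>F\<close>, \<open>\<mm>\<close> for its maximal ideal and \<open>\<kappa>\<close> for the residue
  field. A monomial of \<open>\<phi>\<close> either has an exponent divisible by \<open>p\<close> or a coefficient in \<open>\<mm>\<close>, so the
  derivative of \<open>\<phi>\<close> takes values in \<open>\<mm>\<close> on \<open>\<O>\<close>. A Taylor expansion to first order then gives
  \<open>\<phi>(x) - \<phi>(y) = (x - y) s\<close> with \<open>s \<in> \<mm>\<close> whenever \<open>x\<close> and \<open>y\<close> are integral with the same residue
  (\<open>eval_perturb\<close>). Hence \<open>\<phi>\<close> strictly contracts each residue class into a single class, and two
  distinct periodic points cannot share a class: after a common period their distance would
  have become smaller than itself (\<open>periodic_points_separated\<close>).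

  Outside \<open>\<O>\<close> the leading term dominates because its coefficient is a unit. As \<open>p\<close> divides the
  degree, the degree is at least 2, so such points move away from \<open>\<O>\<close> and never return
  (\<open>periodic_points_in_integer_ring\<close>). The periodic points therefore inject into \<open>\<kappa>\<close>.

  What remains is that \<open>\<kappa>\<close> has at most \<open>p\<close> to the power \<open>f\<close> elements. This requires that \<open>\<kappa>\<close>
  has finite dimension over its prime field, which holds because a list of integers with
  independent residues is independent over the image of \<open>Qp p\<close> (\<open>independent_lift\<close>): a linear relation
  can be scaled so that all coefficients are integral and one of them is 1, and then it reduces to
  a nontrivial relation over the prime field. Coefficients reduce to the prime field since every
  integral p-adic number is congruent to a natural number modulo \<open>\<mm>\<close> (\<open>near_natural\<close>).
\<close>

section \<open>The p-adic valuation of the rationals\<close>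

context
  fixes p :: nat
  assumes prime_p: "Factorial_Ring.prime p"
begin

lemma prime_int_p: "Factorial_Ring.prime (int p)"
  using prime_p by simp

lemma rat_pval_zero [simp]: "rat_pval p 0 = \<infinity>"
  by (simp add: rat_pval_def)

text \<open>
  The fraction need not be reduced, which is what lets sums be computed over a common denominator.
\<close>

lemma rat_pval_fraction:
  fixes a b :: int
  assumes "a \<noteq> 0" "b \<noteq> 0"
  shows "rat_pval p (of_int a / of_int b) =
           ereal (real (multiplicity (int p) a) - real (multiplicity (int p) b))"
proof -
  define q :: rat where "q = of_int a / of_int b"
  obtain r s where rs: "quotient_of q = (r, s)" by (cases "quotient_of q")
  have s: "s > 0" using quotient_of_denom_pos[OF rs] .
  have q: "q = of_int r / of_int s" using quotient_of_div[OF rs] .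
  have "q \<noteq> 0" using assms by (simp add: q_def)
  hence r: "r \<noteq> 0" using q by auto
  have "rat_of_int (a * s) = of_int (r * b)"
    using q q_def assms s by (simp add: field_simps)
  hence "a * s = r * b" by linarith
  hence "multiplicity (int p) (a * s) = multiplicity (int p) (r * b)" by simp
  hence "multiplicity (int p) a + multiplicity (int p) s =
         multiplicity (int p) r + multiplicity (int p) b"
    using assms r s prime_int_p by (simp add: prime_elem_multiplicity_mult_distrib)
  thus ?thesis
    unfolding q_def[symmetric] using \<open>q \<noteq> 0\<close> rs by (simp add: rat_pval_def)
qed

lemma rat_pval_cases:
  obtains "q = 0" | a b where "a \<noteq> 0" "b \<noteq> 0" "q = rat_of_int a / rat_of_int b"
proof (cases "q = 0")
  case False
  obtain r s where rs: "quotient_of q = (r, s)" by (cases "quotient_of q")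
  thus ?thesis
    using that(2)[of r s] quotient_of_denom_pos[OF rs] quotient_of_div[OF rs] False by auto
qed (use that in auto)

lemma rat_pval_finite: "q \<noteq> 0 \<Longrightarrow> \<exists>r. rat_pval p q = ereal r"
  by (simp add: rat_pval_def)

lemma rat_pval_mult: "rat_pval p (x * y) = rat_pval p x + rat_pval p y"
proof (cases "x = 0 \<or> y = 0")
  case True
  thus ?thesis by (auto simp: rat_pval_def)
next
  case False
  obtain a b where ab: "a \<noteq> 0" "b \<noteq> 0" "x = rat_of_int a / rat_of_int b"
    using False by (cases x rule: rat_pval_cases) auto
  obtain c d where cd: "c \<noteq> 0" "d \<noteq> 0" "y = rat_of_int c / rat_of_int d"
    using False by (cases y rule: rat_pval_cases) auto
  have "x * y = of_int (a * c) / of_int (b * d)" using ab cd by simp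
  thus ?thesis
    using ab cd prime_int_p rat_pval_fraction[of "a * c" "b * d"]
    by (simp add: rat_pval_fraction prime_elem_multiplicity_mult_distrib)
qed

lemma rat_pval_add: "min (rat_pval p x) (rat_pval p y) \<le> rat_pval p (x + y)"
proof (cases "x = 0 \<or> y = 0 \<or> x + y = 0")
  case True
  thus ?thesis by auto
next
  case False
  obtain a b where ab: "a \<noteq> 0" "b \<noteq> 0" "x = rat_of_int a / rat_of_int b"
    using False by (cases x rule: rat_pval_cases) auto
  obtain c d where cd: "c \<noteq> 0" "d \<noteq> 0" "y = rat_of_int c / rat_of_int d"
    using False by (cases y rule: rat_pval_cases) auto
  have x: "x = of_int (a * d) / of_int (b * d)" and y: "y = of_int (c * b) / of_int (b * d)"
    using ab cd by (simp_all add: field_simps)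
  have xy: "x + y = of_int (a * d + c * b) / of_int (b * d)"
    unfolding x y by (simp add: add_divide_distrib)
  have nz: "a * d + c * b \<noteq> 0"
  proof
    assume "a * d + c * b = 0"
    thus False using xy False by (metis div_0 of_int_0)
  qed
  let ?k = "min (multiplicity (int p) (a * d)) (multiplicity (int p) (c * b))"
  have "int p ^ ?k dvd a * d + c * b"
    by (intro dvd_add multiplicity_dvd') auto
  hence "?k \<le> multiplicity (int p) (a * d + c * b)"
    using nz prime_int_p by (intro multiplicity_geI) (auto simp: not_prime_unit)
  moreover have "rat_pval p x = ereal (real (multiplicity (int p) (a * d)) - real (multiplicity (int p) (b * d)))"
    unfolding x using ab cd by (intro rat_pval_fraction) auto
  moreover have "rat_pval p y = ereal (real (multiplicity (int p) (c * b)) - real (multiplicity (int p) (b * d)))"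
    unfolding y using ab cd by (intro rat_pval_fraction) auto
  moreover have "rat_pval p (x + y) =
      ereal (real (multiplicity (int p) (a * d + c * b)) - real (multiplicity (int p) (b * d)))"
    unfolding xy using ab cd nz by (intro rat_pval_fraction) auto
  ultimately show ?thesis by (auto simp: min_le_iff_disj)
qed

lemma rat_pval_one: "rat_pval p 1 = 0"
  using rat_pval_fraction[of 1 1] by (simp add: zero_ereal_def)

lemma rat_pval_p: "rat_pval p (rat_of_nat p) = 1"
  using rat_pval_fraction[of "int p" 1] prime_int_p prime_gt_0_nat[OF prime_p]
  by (simp add: one_ereal_def multiplicity_prime)

lemma rat_pval_uminus: "rat_pval p (- x) = rat_pval p x"
proof (cases x rule: rat_pval_cases)
  case (2 a b)
  hence "- x = of_int (- a) / of_int b" by simp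
  moreover have "multiplicity (int p) (- a) = multiplicity (int p) a"
    by (metis multiplicity_normalize_right normalize_int_def abs_minus_cancel)
  ultimately show ?thesis using 2 rat_pval_fraction[of "- a" b] rat_pval_fraction[of a b] by simp
qed simp

lemma rat_pval_diff: "min (rat_pval p x) (rat_pval p y) \<le> rat_pval p (x - y)"
  using rat_pval_add[of x "- y"] by (simp add: rat_pval_uminus)

lemma rat_pval_inverse: "x \<noteq> 0 \<Longrightarrow> rat_pval p (inverse x) = - rat_pval p x"
  using rat_pval_mult[of x "inverse x"] rat_pval_finite[of x] rat_pval_finite[of "inverse x"]
  by (auto simp: rat_pval_one zero_ereal_def)

text \<open>
  The isosceles principle of ultrametric geometry: an error smaller than \<open>x\<close> does not affect its size.
\<close>

lemma rat_pval_eq_if_close: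
  assumes "rat_pval p x < rat_pval p (x - y)"
  shows "rat_pval p y = rat_pval p x"
proof (rule antisym)
  show "rat_pval p x \<le> rat_pval p y"
    using rat_pval_diff[of x "x - y"] assms by simp
  show "rat_pval p y \<le> rat_pval p x"
    using rat_pval_add[of y "x - y"] assms by (auto simp: min_def split: if_splits)
qed

text \<open>
  The denominator is prime to \<open>p\<close>, so it has an inverse modulo \<open>p\<close> by Bezout, and the numerator
  times this inverse is the required residue.
\<close>

lemma rat_pval_nonneg_residue:
  assumes "0 \<le> rat_pval p q"
  shows "\<exists>n::nat. 0 < rat_pval p (q - of_nat n)"
proof (cases "q = 0")
  case True
  thus ?thesis by (intro exI[of _ 0]) simp
next
  case False
  obtain a b where rs: "quotient_of q = (a, b)" by (cases "quotient_of q")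
  have b: "b > 0" and q: "q = of_int a / of_int b" and cop: "coprime a b"
    using quotient_of_denom_pos[OF rs] quotient_of_div[OF rs] quotient_of_coprime[OF rs] by auto
  have a: "a \<noteq> 0" using False q by auto
  have ge: "multiplicity (int p) b \<le> multiplicity (int p) a"
    using assms a b unfolding q by (simp add: rat_pval_fraction)
  have nb: "\<not> int p dvd b"
  proof
    assume *: "int p dvd b"
    hence "0 < multiplicity (int p) b"
      using prime_int_p b by (simp add: prime_multiplicity_gt_zero_iff)
    hence "int p dvd a" using ge by (metis le_zero_eq less_nat_zero_code not_dvd_imp_multiplicity_0)
    thus False using cop * prime_int_p by (meson coprime_def not_prime_unit)
  qed
  hence "coprime b (int p)"
    using prime_imp_coprime[OF prime_int_p] by (simp add: coprime_commute)
  then obtain u w where uw: "u * b + w * int p = 1"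
    by (metis bezout_int coprime_iff_gcd_eq_1)
  define n where "n = nat ((a * u) mod int p)"
  have p0: "int p > 0" using prime_gt_0_nat[OF prime_p] by simp
  have "int n = (a * u) mod int p" using p0 by (simp add: n_def pos_mod_sign)
  have "int p dvd a * u - int n"
    unfolding \<open>int n = _\<close> by (simp add: minus_mod_eq_mult_div)
  then obtain t where t: "a * u - int n = int p * t" by blast
  have "a - b * int n = int p * (a * w + b * t)"
  proof -
    have "a = a * (u * b + w * int p)" using uw by simp
    also have "\<dots> = (a * u) * b + int p * (a * w)" by (simp add: algebra_simps)
    also have "a * u = int n + int p * t" using t by simp
    finally show ?thesis by (simp add: algebra_simps)
  qed
  hence dv: "int p dvd a - b * int n" by simp
  have eq: "q - of_nat n = of_int (a - b * int n) / of_int b"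
    unfolding q using b by (simp add: field_simps)
  have "0 < rat_pval p (q - of_nat n)"
  proof (cases "a - b * int n = 0")
    case True
    thus ?thesis using eq by simp
  next
    case nz: False
    have "0 < multiplicity (int p) (a - b * int n)"
      using dv nz prime_int_p by (simp add: prime_multiplicity_gt_zero_iff)
    moreover have "multiplicity (int p) b = 0"
      using nb by (rule not_dvd_imp_multiplicity_0)
    ultimately show ?thesis
      unfolding eq using rat_pval_fraction[OF nz, of b] b by simp
  qed
  thus ?thesis ..
qed

section \<open>Cauchy sequences and the completion\<close>

lemma padic_null_iff:
  "s \<in> padic_null p \<longleftrightarrow> (\<forall>C::real. \<exists>N. \<forall>n\<ge>N. ereal C \<le> rat_pval p (s n))"
  by (simp add: padic_null_def Lim_PInfty)

lemma padic_cauchyD: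
  assumes "padic_cauchy p s"
  shows "\<exists>N. \<forall>m\<ge>N. \<forall>n\<ge>N. ereal C \<le> rat_pval p (s m - s n)"
  using assms unfolding padic_cauchy_def by blast

lemma padic_nullD:
  assumes "s \<in> padic_null p"
  shows "\<exists>N. \<forall>n\<ge>N. ereal C \<le> rat_pval p (s n)"
  using assms unfolding padic_null_iff by blast

lemma padic_null_imp_cauchy:
  assumes "s \<in> padic_null p" shows "padic_cauchy p s"
  unfolding padic_cauchy_def
proof
  fix C
  obtain N where N: "\<And>n. n \<ge> N \<Longrightarrow> ereal C \<le> rat_pval p (s n)"
    using padic_nullD[OF assms, of C] by blast
  show "\<exists>N. \<forall>m\<ge>N. \<forall>n\<ge>N. ereal C \<le> rat_pval p (s m - s n)"
    using N rat_pval_diff by (meson min.boundedI order_trans)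
qed

text \<open>
  Some bound \<open>C\<close> is missed infinitely often. Beyond the index from which all differences have
  valuation at least \<open>C\<close>, one term of valuation below \<open>C\<close> fixes the valuation of all others by the
  isosceles principle.
\<close>

lemma padic_cauchy_eventually_const_val:
  assumes "padic_cauchy p s" "s \<notin> padic_null p"
  shows "\<exists>N r. \<forall>n\<ge>N. rat_pval p (s n) = ereal r"
proof -
  obtain C where C: "\<And>N. \<exists>n\<ge>N. \<not> ereal C \<le> rat_pval p (s n)"
    using assms(2) unfolding padic_null_iff by blast
  obtain N where N: "\<And>m n. m \<ge> N \<Longrightarrow> n \<ge> N \<Longrightarrow> ereal C \<le> rat_pval p (s m - s n)"
    using padic_cauchyD[OF assms(1), of C] by blast
  obtain k where k: "k \<ge> N" "rat_pval p (s k) < ereal C"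
    using C[of N] by (auto simp: not_le)
  have "s k \<noteq> 0" using k by auto
  then obtain r where r: "rat_pval p (s k) = ereal r"
    using rat_pval_finite by blast
  have "rat_pval p (s n) = ereal r" if "n \<ge> N" for n
    using rat_pval_eq_if_close[of "s k" "s n"] less_le_trans[OF k(2) N[OF k(1) that]] r by simp
  thus ?thesis by blast
qed

lemma padic_cauchy_bounded:
  assumes "padic_cauchy p s"
  shows "\<exists>N B. \<forall>n\<ge>N. ereal B \<le> rat_pval p (s n)"
proof (cases "s \<in> padic_null p")
  case True
  show ?thesis using padic_nullD[OF True, of 0] by blast
next
  case False
  show ?thesis using padic_cauchy_eventually_const_val[OF assms False] by (metis order_refl)
qed

lemma padic_cauchy_const: "padic_cauchy p (\<lambda>n. c)"
  by (simp add: padic_cauchy_def)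

lemma padic_cauchy_uminus:
  assumes "padic_cauchy p s" shows "padic_cauchy p (\<lambda>n. - s n)"
proof -
  have "rat_pval p (- s m - - s n) = rat_pval p (s m - s n)" for m n
    using rat_pval_uminus[of "s m - s n"] by simp
  thus ?thesis using assms by (simp add: padic_cauchy_def)
qed

lemma padic_cauchy_add:
  assumes "padic_cauchy p s" "padic_cauchy p t" shows "padic_cauchy p (\<lambda>n. s n + t n)"
  unfolding padic_cauchy_def
proof
  fix C
  obtain N where N: "\<And>m n. m \<ge> N \<Longrightarrow> n \<ge> N \<Longrightarrow> ereal C \<le> rat_pval p (s m - s n)"
    using padic_cauchyD[OF assms(1), of C] by blast
  obtain M where M: "\<And>m n. m \<ge> M \<Longrightarrow> n \<ge> M \<Longrightarrow> ereal C \<le> rat_pval p (t m - t n)"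
    using padic_cauchyD[OF assms(2), of C] by blast
  have "ereal C \<le> rat_pval p (s m + t m - (s n + t n))" if "m \<ge> max N M" "n \<ge> max N M" for m n
  proof -
    have "s m + t m - (s n + t n) = (s m - s n) + (t m - t n)" by simp
    thus ?thesis
      using N[of m n] M[of m n] that rat_pval_add[of "s m - s n" "t m - t n"]
      by (metis max.bounded_iff min.boundedI order_trans)
  qed
  thus "\<exists>N. \<forall>m\<ge>N. \<forall>n\<ge>N. ereal C \<le> rat_pval p (s m + t m - (s n + t n))" by blast
qed

lemma padic_cauchy_mult:
  assumes "padic_cauchy p s" "padic_cauchy p t" shows "padic_cauchy p (\<lambda>n. s n * t n)"
  unfolding padic_cauchy_def
proof
  fix C
  obtain N1 B1 where B1: "\<And>n. n \<ge> N1 \<Longrightarrow> ereal B1 \<le> rat_pval p (s n)"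
    using padic_cauchy_bounded[OF assms(1)] by blast
  obtain N2 B2 where B2: "\<And>n. n \<ge> N2 \<Longrightarrow> ereal B2 \<le> rat_pval p (t n)"
    using padic_cauchy_bounded[OF assms(2)] by blast
  obtain N where N: "\<And>m n. m \<ge> N \<Longrightarrow> n \<ge> N \<Longrightarrow> ereal (C - B2) \<le> rat_pval p (s m - s n)"
    using padic_cauchyD[OF assms(1), of "C - B2"] by blast
  obtain M where M: "\<And>m n. m \<ge> M \<Longrightarrow> n \<ge> M \<Longrightarrow> ereal (C - B1) \<le> rat_pval p (t m - t n)"
    using padic_cauchyD[OF assms(2), of "C - B1"] by blast
  have "ereal C \<le> rat_pval p (s m * t m - s n * t n)"
    if "m \<ge> N1 + N2 + N + M" "n \<ge> N1 + N2 + N + M" for m n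
  proof -
    have "ereal B1 + ereal (C - B1) \<le> rat_pval p (s m * (t m - t n))"
      using B1[of m] M[of m n] that by (simp only: rat_pval_mult) (intro add_mono; simp)
    moreover have "ereal (C - B2) + ereal B2 \<le> rat_pval p ((s m - s n) * t n)"
      using B2[of n] N[of m n] that by (simp only: rat_pval_mult) (intro add_mono; simp)
    moreover have "s m * t m - s n * t n = s m * (t m - t n) + (s m - s n) * t n"
      by (simp add: algebra_simps)
    ultimately show ?thesis
      using rat_pval_add[of "s m * (t m - t n)" "(s m - s n) * t n"]
      by (auto simp: min_le_iff_disj intro: order_trans)
  qed
  thus "\<exists>N. \<forall>m\<ge>N. \<forall>n\<ge>N. ereal C \<le> rat_pval p (s m * t m - s n * t n)" by blast
qed

lemma padic_cauchy_inverse: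
  assumes "padic_cauchy p s" "s \<notin> padic_null p"
  shows "padic_cauchy p (\<lambda>n. inverse (s n))"
  unfolding padic_cauchy_def
proof
  fix C
  obtain K r where K: "\<And>n. n \<ge> K \<Longrightarrow> rat_pval p (s n) = ereal r"
    using padic_cauchy_eventually_const_val[OF assms] by blast
  \<comment> \<open>Dividing a difference by two terms of valuation \<open>r\<close> costs \<open>2 * r\<close>.\<close>
  obtain N where N: "\<And>m n. m \<ge> N \<Longrightarrow> n \<ge> N \<Longrightarrow> ereal (C + 2 * r) \<le> rat_pval p (s m - s n)"
    using padic_cauchyD[OF assms(1), of "C + 2 * r"] by blast
  have "ereal C \<le> rat_pval p (inverse (s m) - inverse (s n))"
    if "m \<ge> max K N" "n \<ge> max K N" for m n
  proof -
    have nz: "s m \<noteq> 0" "s n \<noteq> 0" using K[of m] K[of n] that by auto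
    have "inverse (s m) - inverse (s n) = inverse (s m) * ((s n - s m) * inverse (s n))"
      using nz by (simp add: field_simps)
    hence "rat_pval p (inverse (s m) - inverse (s n)) =
             ereal (- r) + (rat_pval p (s n - s m) + ereal (- r))"
      using nz K that by (simp add: rat_pval_mult rat_pval_inverse)
    moreover have "ereal (- r) + (ereal (C + 2 * r) + ereal (- r)) \<le> \<dots>"
      using N[of n m] that by (intro add_mono) auto
    ultimately show ?thesis by simp
  qed
  thus "\<exists>N. \<forall>m\<ge>N. \<forall>n\<ge>N. ereal C \<le> rat_pval p (inverse (s m) - inverse (s n))" by blast
qed

lemma cring_padic_cauchy_ring: "cring (padic_cauchy_ring p)"
proof (intro cringI abelian_groupI comm_monoidI)
  fix s assume "s \<in> carrier (padic_cauchy_ring p)"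
  thus "\<exists>y\<in>carrier (padic_cauchy_ring p).
          y \<oplus>\<^bsub>padic_cauchy_ring p\<^esub> s = \<zero>\<^bsub>padic_cauchy_ring p\<^esub>"
    by (intro bexI[of _ "\<lambda>n. - s n"]) (auto simp: padic_cauchy_ring_def padic_cauchy_uminus)
qed (auto simp: padic_cauchy_ring_def padic_cauchy_add padic_cauchy_mult padic_cauchy_const
       algebra_simps)

interpretation C: cring "padic_cauchy_ring p"
  by (rule cring_padic_cauchy_ring)

lemma padic_cauchy_ring_a_inv:
  assumes "padic_cauchy p s"
  shows "\<ominus>\<^bsub>padic_cauchy_ring p\<^esub> s = (\<lambda>n. - s n)"
  by (rule C.minus_equality)
     (use assms padic_cauchy_uminus in \<open>auto simp: padic_cauchy_ring_def\<close>)

lemma ideal_padic_null: "ideal (padic_null p) (padic_cauchy_ring p)"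
proof (rule idealI)
  show "ring (padic_cauchy_ring p)" by (rule C.ring_axioms)
  show "subgroup (padic_null p) (add_monoid (padic_cauchy_ring p))"
  proof (rule C.add.subgroupI)
    show "padic_null p \<subseteq> carrier (padic_cauchy_ring p)"
      using padic_null_imp_cauchy by (auto simp: padic_cauchy_ring_def)
    have "(\<lambda>n. 0) \<in> padic_null p" by (simp add: padic_null_iff)
    thus "padic_null p \<noteq> {}" by blast
  next
    fix s assume s: "s \<in> padic_null p"
    thus "\<ominus>\<^bsub>padic_cauchy_ring p\<^esub> s \<in> padic_null p"
      using padic_null_imp_cauchy
      by (simp add: padic_cauchy_ring_a_inv padic_null_iff rat_pval_uminus)
  next
    fix s t assume s: "s \<in> padic_null p" and t: "t \<in> padic_null p"
    have "\<exists>N. \<forall>n\<ge>N. ereal C \<le> rat_pval p (s n + t n)" for C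
    proof -
      obtain N where N: "\<And>n. n \<ge> N \<Longrightarrow> ereal C \<le> rat_pval p (s n)" using padic_nullD[OF s, of C] by blast
      obtain M where M: "\<And>n. n \<ge> M \<Longrightarrow> ereal C \<le> rat_pval p (t n)" using padic_nullD[OF t, of C] by blast
      have "ereal C \<le> rat_pval p (s n + t n)" if "n \<ge> max N M" for n
        using that N[of n] M[of n] rat_pval_add[of "s n" "t n"]
        by (metis max.bounded_iff min.boundedI order_trans)
      thus ?thesis by blast
    qed
    thus "s \<oplus>\<^bsub>padic_cauchy_ring p\<^esub> t \<in> padic_null p"
      by (simp add: padic_cauchy_ring_def padic_null_iff)
  qed
next
  fix s t assume s: "s \<in> padic_null p" and t: "t \<in> carrier (padic_cauchy_ring p)"
  obtain N B where B: "\<And>n. n \<ge> N \<Longrightarrow> ereal B \<le> rat_pval p (t n)"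
    using padic_cauchy_bounded[of t] t unfolding padic_cauchy_ring_def by fastforce
  have "\<exists>N. \<forall>n\<ge>N. ereal C \<le> rat_pval p (s n * t n)" for C
  proof -
    obtain M where M: "\<And>n. n \<ge> M \<Longrightarrow> ereal (C - B) \<le> rat_pval p (s n)" using padic_nullD[OF s, of "C - B"] by blast
    have "ereal C \<le> rat_pval p (s n * t n)" if "n \<ge> max N M" for n
    proof -
      have "ereal (C - B) + ereal B \<le> rat_pval p (s n) + rat_pval p (t n)"
        using that by (intro add_mono M B) auto
      thus ?thesis by (simp add: rat_pval_mult)
    qed
    thus ?thesis by blast
  qed
  thus "s \<otimes>\<^bsub>padic_cauchy_ring p\<^esub> t \<in> padic_null p"
       "t \<otimes>\<^bsub>padic_cauchy_ring p\<^esub> s \<in> padic_null p"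
    by (simp_all add: padic_cauchy_ring_def padic_null_iff mult.commute)
qed

definition Qp_class :: "(nat \<Rightarrow> rat) \<Rightarrow> (nat \<Rightarrow> rat) set" where
  "Qp_class s = padic_null p +>\<^bsub>padic_cauchy_ring p\<^esub> s"

lemma mem_Qp_class: "t \<in> Qp_class s \<longleftrightarrow> (\<lambda>n. t n - s n) \<in> padic_null p"
proof
  assume "t \<in> Qp_class s"
  then obtain z where "z \<in> padic_null p" "t = (\<lambda>n. z n + s n)"
    by (auto simp: Qp_class_def a_r_coset_def r_coset_def padic_cauchy_ring_def)
  thus "(\<lambda>n. t n - s n) \<in> padic_null p" by simp
next
  assume *: "(\<lambda>n. t n - s n) \<in> padic_null p"
  hence "\<exists>z\<in>padic_null p. t = (\<lambda>n. z n + s n)"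
    by (rule bexI[rotated]) simp
  thus "t \<in> Qp_class s"
    by (simp add: Qp_class_def a_r_coset_def r_coset_def padic_cauchy_ring_def)
qed

lemma Qp_class_eqI:
  assumes "padic_cauchy p s" "padic_cauchy p t" "(\<lambda>n. s n - t n) \<in> padic_null p"
  shows "Qp_class s = Qp_class t"
proof -
  have "s \<ominus>\<^bsub>padic_cauchy_ring p\<^esub> t = (\<lambda>n. s n - t n)"
    unfolding a_minus_def padic_cauchy_ring_a_inv[OF assms(2)]
    by (simp add: padic_cauchy_ring_def)
  thus ?thesis
    unfolding Qp_class_def
    using C.quotient_eq_iff_same_a_r_cos[OF ideal_padic_null, of s t] assms
    by (simp add: padic_cauchy_ring_def)
qed

lemma Qp_class_hom: "Qp_class \<in> ring_hom (padic_cauchy_ring p) (Qp p)"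
  unfolding Qp_def using ideal.rcos_ring_hom[OF ideal_padic_null]
  by (simp add: Qp_class_def[abs_def])

lemma carrier_Qp: "carrier (Qp p) = Qp_class ` {s. padic_cauchy p s}"
proof -
  have "carrier (padic_cauchy_ring p) = {s. padic_cauchy p s}"
    by (simp add: padic_cauchy_ring_def)
  thus ?thesis by (auto simp: Qp_def FactRing_def A_RCOSETS_def' Qp_class_def)
qed

lemma Qp_val_class_null:
  assumes "s \<in> padic_null p" shows "Qp_val p (Qp_class s) = \<infinity>"
proof -
  have self: "s \<in> Qp_class s"
    by (simp add: mem_Qp_class padic_null_iff)
  have "t \<in> padic_null p" if t: "t \<in> Qp_class s" for t
    unfolding padic_null_iff
  proof
    fix C
    obtain N where N: "\<And>n. n \<ge> N \<Longrightarrow> ereal C \<le> rat_pval p (s n)" using padic_nullD[OF assms, of C] by blast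
    obtain M where M: "\<And>n. n \<ge> M \<Longrightarrow> ereal C \<le> rat_pval p (t n - s n)"
      using padic_nullD[OF t[unfolded mem_Qp_class], of C] by blast
    have "ereal C \<le> rat_pval p (t n)" if "n \<ge> max N M" for n
      using that N[of n] M[of n] rat_pval_add[of "t n - s n" "s n"]
      by (metis diff_add_cancel max.bounded_iff min.boundedI order_trans)
    thus "\<exists>N. \<forall>n\<ge>N. ereal C \<le> rat_pval p (t n)" by blast
  qed
  thus ?thesis
    unfolding Qp_val_def using self
    by (intro the_equality) (auto simp: padic_null_def intro: LIMSEQ_unique)
qed

text \<open>
  Another representative differs by a null sequence, and the isosceles principle makes its terms
  eventually have the same valuation. So all representatives have the same limit, as the definite
  description in \<open>Qp_val\<close> demands.
\<close>

lemma Qp_val_class_eventually: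
  assumes "\<And>n. n \<ge> N \<Longrightarrow> rat_pval p (s n) = ereal r"
  shows "Qp_val p (Qp_class s) = ereal r"
proof -
  have self: "s \<in> Qp_class s"
    by (simp add: mem_Qp_class padic_null_iff)
  have "(\<lambda>n. rat_pval p (t n)) \<longlonglongrightarrow> ereal r" if t: "t \<in> Qp_class s" for t
  proof -
    obtain M where M: "\<And>n. n \<ge> M \<Longrightarrow> ereal (r + 1) \<le> rat_pval p (t n - s n)"
      using padic_nullD[OF t[unfolded mem_Qp_class], of "r + 1"] by blast
    have "rat_pval p (t n) = ereal r" if "n \<ge> max N M" for n
    proof -
      have "rat_pval p (s n) < rat_pval p (s n - t n)"
        using assms[of n] M[of n] that rat_pval_uminus[of "t n - s n"]
        by (auto intro: less_le_trans[of _ "ereal (r + 1)"])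
      thus ?thesis using rat_pval_eq_if_close[of "s n" "t n"] assms[of n] that by simp
    qed
    hence "eventually (\<lambda>n. rat_pval p (t n) = ereal r) sequentially"
      unfolding eventually_sequentially by blast
    thus ?thesis by (rule tendsto_eventually)
  qed
  thus ?thesis
    unfolding Qp_val_def using self by (intro the_equality) (auto intro: LIMSEQ_unique)
qed

lemma Qp_val_class_const: "Qp_val p (Qp_class (\<lambda>n. q)) = rat_pval p q"
proof (cases "q = 0")
  case True
  have "(\<lambda>n. q) \<in> padic_null p" by (simp add: True padic_null_iff)
  thus ?thesis using True by (simp add: Qp_val_class_null)
next
  case False
  then obtain r where "rat_pval p q = ereal r" using rat_pval_finite[of q] by blast
  thus ?thesis using Qp_val_class_eventually[of 0 "\<lambda>n. q" r] by simp
qed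

lemma Qp_val_class_ge:
  assumes "padic_cauchy p s" "\<And>n. n \<ge> N \<Longrightarrow> ereal C \<le> rat_pval p (s n)"
  shows "ereal C \<le> Qp_val p (Qp_class s)"
proof (cases "s \<in> padic_null p")
  case False
  obtain M r where M: "\<And>n. n \<ge> M \<Longrightarrow> rat_pval p (s n) = ereal r"
    using padic_cauchy_eventually_const_val[OF assms(1) False] by blast
  show ?thesis
    using M[of "max M N"] assms(2)[of "max M N"] Qp_val_class_eventually[OF M] by simp
qed (simp add: Qp_val_class_null)

text \<open>
  A late term of the sequence approximates the class.
\<close>

lemma Qp_class_near_rational:
  assumes "padic_cauchy p s"
  obtains q where "1 \<le> Qp_val p (Qp_class (\<lambda>n. s n - q))"
proof -
  obtain N where N: "\<And>m n. m \<ge> N \<Longrightarrow> n \<ge> N \<Longrightarrow> ereal 1 \<le> rat_pval p (s m - s n)"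
    using padic_cauchyD[OF assms, of 1] by blast
  have "padic_cauchy p (\<lambda>n. s n - s N)"
    using padic_cauchy_add[OF assms padic_cauchy_const, of "- s N"] by simp
  thus ?thesis using Qp_val_class_ge[of "\<lambda>n. s n - s N" N 1] N that[of "s N"]
    by (simp add: one_ereal_def)
qed

text \<open>
  A sequence that is not null can be inverted termwise. Its finitely many zero terms have inverse 0,
  so the product with the original sequence is 1 only from some index on, which suffices modulo
  null sequences.
\<close>

lemma Qp_inverse_exists:
  assumes "x \<in> carrier (Qp p)" "x \<noteq> \<zero>\<^bsub>Qp p\<^esub>"
  shows "\<exists>y\<in>carrier (Qp p). x \<otimes>\<^bsub>Qp p\<^esub> y = \<one>\<^bsub>Qp p\<^esub>"
proof -
  obtain s where s: "padic_cauchy p s" "x = Qp_class s" using assms(1) by (auto simp: carrier_Qp)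
  have z: "\<zero>\<^bsub>Qp p\<^esub> = padic_null p" by (simp add: Qp_def FactRing_def)
  have nn: "s \<notin> padic_null p"
  proof
    assume "s \<in> padic_null p"
    hence "x = Qp_class (\<lambda>n. 0)"
      unfolding s(2) using s(1) padic_cauchy_const[of 0] by (intro Qp_class_eqI) simp_all
    also have "\<dots> = padic_null p" by (auto simp: mem_Qp_class)
    finally have "x = padic_null p" .
    thus False using assms(2) z by simp
  qed
  obtain N r where N: "\<And>n. n \<ge> N \<Longrightarrow> rat_pval p (s n) = ereal r"
    using padic_cauchy_eventually_const_val[OF s(1) nn] by blast
  have nz: "s n \<noteq> 0" if "n \<ge> N" for n using N[OF that] by auto
  let ?t = "\<lambda>n. inverse (s n)"
  have t: "padic_cauchy p ?t" using padic_cauchy_inverse[OF s(1) nn] .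
  have "x \<otimes>\<^bsub>Qp p\<^esub> Qp_class ?t = Qp_class (\<lambda>n. s n * ?t n)"
    using ring_hom_mult[OF Qp_class_hom, of s ?t] s t by (simp add: padic_cauchy_ring_def)
  also have "\<dots> = Qp_class (\<lambda>n. 1)"
  proof -
    have "(\<lambda>n. s n * ?t n - 1) \<in> padic_null p"
      unfolding padic_null_iff using nz
      by (auto intro!: exI[of _ N])
    thus ?thesis
      using Qp_class_eqI[OF padic_cauchy_mult[OF s(1) t] padic_cauchy_const[of 1]] by simp
  qed
  also have "\<dots> = \<one>\<^bsub>Qp p\<^esub>"
    using ring_hom_one[OF Qp_class_hom] by (simp add: padic_cauchy_ring_def)
  finally show ?thesis using t by (auto simp: carrier_Qp)
qed

end

section \<open>Valued fields and their residue fields\<close>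

locale valued_field = field F for F (structure) +
  fixes v :: "'a \<Rightarrow> ereal"
  assumes val_ne_minf: "x \<in> carrier F \<Longrightarrow> v x \<noteq> - \<infinity>"
    and val_inf_iff: "x \<in> carrier F \<Longrightarrow> v x = \<infinity> \<longleftrightarrow> x = \<zero>"
    and val_mult: "x \<in> carrier F \<Longrightarrow> y \<in> carrier F \<Longrightarrow> v (x \<otimes> y) = v x + v y"
    and val_add: "x \<in> carrier F \<Longrightarrow> y \<in> carrier F \<Longrightarrow> min (v x) (v y) \<le> v (x \<oplus> y)"
begin

lemma val_zero [simp]: "v \<zero> = \<infinity>"
  by (simp add: val_inf_iff)

lemma val_finite: "x \<in> carrier F \<Longrightarrow> x \<noteq> \<zero> \<Longrightarrow> \<bar>v x\<bar> \<noteq> \<infinity>"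
  using val_ne_minf val_inf_iff by auto

lemma val_real: "x \<in> carrier F \<Longrightarrow> x \<noteq> \<zero> \<Longrightarrow> \<exists>r. v x = ereal r"
  using val_finite by (metis ereal_real)

lemma val_one [simp]: "v \<one> = 0"
  using val_mult[of \<one> \<one>] val_real[of \<one>] by (auto simp: zero_ereal_def)

lemma val_a_inv: "x \<in> carrier F \<Longrightarrow> v (\<ominus> x) = v x"
proof -
  assume x: "x \<in> carrier F"
  have "\<ominus> \<one> \<otimes> \<ominus> \<one> = \<one>" by (simp add: l_minus)
  hence "v (\<ominus> \<one>) + v (\<ominus> \<one>) = 0"
    using val_mult[of "\<ominus> \<one>" "\<ominus> \<one>"] by simp
  hence "v (\<ominus> \<one>) = 0"
    using val_ne_minf[of "\<ominus> \<one>"] by (cases "v (\<ominus> \<one>)") (auto simp: zero_ereal_def)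
  thus ?thesis using val_mult[of "\<ominus> \<one>" x] x by (simp add: l_minus)
qed

lemma val_diff: "x \<in> carrier F \<Longrightarrow> y \<in> carrier F \<Longrightarrow> min (v x) (v y) \<le> v (x \<ominus> y)"
  using val_add[of x "\<ominus> y"] by (simp add: a_minus_def val_a_inv)

lemma val_inv:
  assumes "x \<in> carrier F" "x \<noteq> \<zero>" shows "inv x \<in> carrier F" "v (inv x) = - v x"
proof -
  have u: "x \<in> Units F" using assms by (simp add: field_Units)
  thus i: "inv x \<in> carrier F" by simp
  have "v x + v (inv x) = 0" using u assms val_mult[of x "inv x"] i by simp
  thus "v (inv x) = - v x"
    using val_real[OF assms] val_ne_minf[OF i] by (cases "v (inv x)") (auto simp: zero_ereal_def)
qed

abbreviation "\<O> \<equiv> integer_ring F v"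
abbreviation "\<mm> \<equiv> max_ideal F v"
abbreviation "\<O>_ring \<equiv> F\<lparr>carrier := \<O>\<rparr>"

lemma subring_integer_ring: "subring \<O> F"
proof (rule subringI)
  fix x y assume "x \<in> \<O>" "y \<in> \<O>"
  thus "x \<otimes> y \<in> \<O>" "x \<oplus> y \<in> \<O>"
    using val_add[of x y] by (auto simp: integer_ring_def val_mult min_def split: if_splits)
qed (auto simp: integer_ring_def val_a_inv)

lemma max_ideal_subset: "\<mm> \<subseteq> \<O>"
  by (auto simp: integer_ring_def max_ideal_def)

lemma cring_integer_ring: "cring \<O>_ring"
  using subcring_iff[of \<O>] subcringI'[OF subring_integer_ring] subringE(1)[OF subring_integer_ring]
  by simp

lemma max_ideal_add: "x \<in> \<mm> \<Longrightarrow> y \<in> \<mm> \<Longrightarrow> x \<oplus> y \<in> \<mm>"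
  using val_add[of x y] by (auto simp: max_ideal_def min_def split: if_splits)

lemma max_ideal_mult: "x \<in> \<O> \<Longrightarrow> y \<in> \<mm> \<Longrightarrow> x \<otimes> y \<in> \<mm>"
  by (auto simp: max_ideal_def integer_ring_def val_mult intro: add_nonneg_pos)

lemma a_inv_integer_ring: "x \<in> \<O> \<Longrightarrow> \<ominus>\<^bsub>\<O>_ring\<^esub> x = \<ominus> x"
proof -
  interpret O: cring \<O>_ring by (rule cring_integer_ring)
  assume x: "x \<in> \<O>"
  thus ?thesis using subringE(5)[OF subring_integer_ring x]
    by (intro O.minus_equality) (auto simp: integer_ring_def l_neg)
qed

lemma ideal_max_ideal: "ideal \<mm> \<O>_ring"
proof (rule idealI)
  interpret O: cring \<O>_ring by (rule cring_integer_ring)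
  show "ring \<O>_ring" by (rule O.ring_axioms)
  show "subgroup \<mm> (add_monoid \<O>_ring)"
  proof (rule O.add.subgroupI)
    show "\<mm> \<noteq> {}" using zero_closed by (force simp: max_ideal_def)
    fix x assume "x \<in> \<mm>"
    thus "\<ominus>\<^bsub>\<O>_ring\<^esub> x \<in> \<mm>"
      using max_ideal_subset by (subst a_inv_integer_ring) (auto simp: max_ideal_def val_a_inv)
  qed (use max_ideal_subset max_ideal_add in auto)
next
  fix x y assume "x \<in> \<mm>" "y \<in> carrier \<O>_ring"
  thus "y \<otimes>\<^bsub>\<O>_ring\<^esub> x \<in> \<mm>" "x \<otimes>\<^bsub>\<O>_ring\<^esub> y \<in> \<mm>"
    using max_ideal_mult[of y x] m_comm[of x y] by (auto simp: integer_ring_def max_ideal_def)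
qed

lemma maximalideal_max_ideal: "maximalideal \<mm> \<O>_ring"
proof (rule maximalidealI)
  show "ideal \<mm> \<O>_ring" by (rule ideal_max_ideal)
  have "\<one> \<in> \<O>" "\<one> \<notin> \<mm>" by (auto simp: integer_ring_def max_ideal_def)
  thus "carrier \<O>_ring \<noteq> \<mm>" by auto
next
  fix J assume J: "ideal J \<O>_ring" "\<mm> \<subseteq> J" "J \<subseteq> carrier \<O>_ring"
  show "J = \<mm> \<or> J = carrier \<O>_ring"
  proof (rule disjCI)
    assume "J \<noteq> carrier \<O>_ring"
    hence "\<one> \<notin> J" using ideal.one_imp_carrier[OF J(1)] by auto
    have "x \<in> \<mm>" if x: "x \<in> J" for x
    proof (rule ccontr)
      \<comment> \<open>An integral element outside the maximal ideal has valuation 0, so its inverse is integral too.\<close>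
      assume "x \<notin> \<mm>"
      hence vx: "x \<in> carrier F" "v x = 0"
        using J(3) x by (auto simp: integer_ring_def max_ideal_def)
      hence nz: "x \<noteq> \<zero>" by auto
      hence "inv x \<in> \<O>" using val_inv[OF vx(1)] vx by (simp add: integer_ring_def)
      hence "inv x \<otimes> x \<in> J" using ideal.I_l_closed[OF J(1) x] by simp
      thus False using \<open>\<one> \<notin> J\<close> vx nz by (simp add: field_Units)
    qed
    thus "J = \<mm>" using J(2) by blast
  qed
qed

abbreviation "\<kappa> \<equiv> residue_field F v"

lemma field_residue_field: "field \<kappa>"
  unfolding residue_field_def
  by (rule maximalideal.quotient_is_field[OF maximalideal_max_ideal cring_integer_ring])

definition residue :: "'a \<Rightarrow> 'a set" where
  "residue x = \<mm> +>\<^bsub>\<O>_ring\<^esub> x"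

lemma residue_hom: "residue \<in> ring_hom \<O>_ring \<kappa>"
  unfolding residue_field_def residue_def[abs_def]
  by (rule ideal.rcos_ring_hom[OF ideal_max_ideal])

lemma residue_simps:
  assumes "x \<in> \<O>" "y \<in> \<O>"
  shows "residue (x \<otimes> y) = residue x \<otimes>\<^bsub>\<kappa>\<^esub> residue y"
    and "residue (x \<oplus> y) = residue x \<oplus>\<^bsub>\<kappa>\<^esub> residue y"
  using ring_hom_mult[OF residue_hom] ring_hom_add[OF residue_hom] assms by auto

lemma residue_one: "residue \<one> = \<one>\<^bsub>\<kappa>\<^esub>"
  using ring_hom_one[OF residue_hom] by simp

lemma carrier_residue_field: "carrier \<kappa> = residue ` \<O>"
  by (auto simp: residue_field_def FactRing_def A_RCOSETS_def' residue_def)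

lemma residue_eq_iff:
  assumes "x \<in> \<O>" "y \<in> \<O>"
  shows "residue x = residue y \<longleftrightarrow> x \<ominus> y \<in> \<mm>"
proof -
  interpret I: ideal \<mm> \<O>_ring by (rule ideal_max_ideal)
  have "x \<ominus>\<^bsub>\<O>_ring\<^esub> y = x \<ominus> y"
    unfolding a_minus_def a_inv_integer_ring[OF assms(2)] by simp
  thus ?thesis
    unfolding residue_def
    using I.quotient_eq_iff_same_a_r_cos[OF ideal_max_ideal, of x y] assms by auto
qed

lemma residue_zero: "residue \<zero> = \<zero>\<^bsub>\<kappa>\<^esub>"
  using ring_hom_zero[OF residue_hom cring.axioms(1)[OF cring_integer_ring]]
    field_residue_field by (simp add: field_def domain_def cring_def)

lemma residue_eq_zero_iff: "x \<in> \<O> \<Longrightarrow> residue x = \<zero>\<^bsub>\<kappa>\<^esub> \<longleftrightarrow> x \<in> \<mm>"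
  using residue_eq_iff[of x \<zero>] subringE(2)[OF subring_integer_ring]
  by (auto simp: residue_zero a_minus_def integer_ring_def)

end

section \<open>The number of residue classes\<close>

text \<open>
  The natural multiples of 1 already form a subfield: the multiple \<open>p - 1\<close> acts as -1, and a
  multiple prime to \<open>p\<close> is inverted by Bezout.
\<close>

lemma (in field) prime_field_subset_multiples_of_one:
  assumes "Factorial_Ring.prime p" "[p] \<cdot> \<one> = \<zero>"
  shows "generate_field R {} \<subseteq> (\<lambda>n::nat. [n] \<cdot> \<one>) ` {..<p}"
proof -
  let ?E = "range (\<lambda>n::nat. [n] \<cdot> \<one>)"
  have zero: "[(p * n)] \<cdot> \<one> = \<zero>" for n :: nat
    using add.nat_pow_pow[of \<one> n p] assms(2) by simp
  have mult: "[m] \<cdot> \<one> \<otimes> [n] \<cdot> \<one> = [(m * n)] \<cdot> \<one>" for m n :: nat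
    by (simp add: add_pow_ldistr add.nat_pow_pow mult.commute)
  have "subfield ?E R"
  proof (rule subfieldI')
    show "subring ?E R"
    proof (rule subringI)
      have "\<one> = [(1::nat)] \<cdot> \<one>" by simp
      thus "\<one> \<in> ?E" by blast
    next
      fix x assume "x \<in> ?E"
      then obtain n :: nat where n: "x = [n] \<cdot> \<one>" by blast
      have "(p - 1) * n + n = p * n"
        using prime_gt_0_nat[OF assms(1)] by (cases p) auto
      hence "[((p - 1) * n)] \<cdot> \<one> \<oplus> x = \<zero>"
        unfolding n using add.nat_pow_mult[of \<one> "(p - 1) * n" n] zero[of n] by simp
      hence "\<ominus> x = [((p - 1) * n)] \<cdot> \<one>"
        unfolding n by (intro minus_equality) auto
      thus "\<ominus> x \<in> ?E" by blast
    next
      fix x y assume "x \<in> ?E" "y \<in> ?E"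
      then obtain m n :: nat where "x = [m] \<cdot> \<one>" "y = [n] \<cdot> \<one>" by blast
      thus "x \<otimes> y \<in> ?E" "x \<oplus> y \<in> ?E"
        using mult[of m n] add.nat_pow_mult[of \<one> m n] by auto
    qed auto
  next
    fix x assume x: "x \<in> ?E - {\<zero>}"
    then obtain n :: nat where n: "x = [n] \<cdot> \<one>" by blast
    have "\<not> p dvd n"
      using x zero unfolding n by (auto elim!: dvdE)
    hence "gcd n p = 1" "n \<noteq> 0"
      using prime_imp_coprime[OF assms(1), of n] by (auto simp: coprime_iff_gcd_eq_1 gcd.commute intro!: gr0I)
    then obtain i j where "n * i = p * j + 1"
      using bezout_nat[of n p] by auto
    hence "x \<otimes> [i] \<cdot> \<one> = \<one>"
      unfolding n mult using add.nat_pow_mult[of \<one> "p * j" 1] zero[of j] by simp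
    hence "inv x = [i] \<cdot> \<one>"
      unfolding n by (intro comm_inv_char) auto
    thus "inv x \<in> ?E" by blast
  qed
  hence "generate_field R {} \<subseteq> ?E"
    by (intro generate_field_min_subfield1) auto
  moreover have "[n] \<cdot> \<one> \<in> (\<lambda>n::nat. [n] \<cdot> \<one>) ` {..<p}" for n :: nat
  proof -
    have "[n] \<cdot> \<one> = [(p * (n div p))] \<cdot> \<one> \<oplus> [(n mod p)] \<cdot> \<one>"
      using add.nat_pow_mult[of \<one> "p * (n div p)" "n mod p"] by simp
    hence "[n] \<cdot> \<one> = [(n mod p)] \<cdot> \<one>" by (simp add: zero)
    moreover have "n mod p \<in> {..<p}" using prime_gt_0_nat[OF assms(1)] by simp
    ultimately show ?thesis by (simp only:) (rule imageI)
  qed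
  ultimately show ?thesis by blast
qed

lemma (in field) multiples_of_one_in_prime_field: "[(n::nat)] \<cdot> \<one> \<in> generate_field R {}"
proof (induction n)
  case 0
  thus ?case using zero_in_generate[of "{}"] by simp
next
  case (Suc n)
  thus ?case using generate_field.eng_add[OF Suc generate_field.one] by simp
qed

text \<open>
  Each extension by a line multiplies the number of elements by at most the number of scalars.
\<close>

lemma (in ring) card_le_of_dimension:
  assumes "dimension n K E" "finite K"
  shows "finite E \<and> card E \<le> card K ^ n"
  using assms
proof (induction n K E)
  case (zero_dim K)
  show ?case by simp
next
  case (Suc_dim u E n K)
  have eq: "line_extension K u E = (\<lambda>(c, e). c \<otimes> u \<oplus> e) ` (K \<times> E)"
    unfolding set_eq_iff line_extension_mem_iff by auto
  have "card (line_extension K u E) \<le> card (K \<times> E)"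
    unfolding eq using Suc_dim by (intro card_image_le) auto
  also have "\<dots> \<le> card K * card K ^ n"
    using Suc_dim by (simp add: card_cartesian_product)
  finally show ?case using Suc_dim by (simp add: eq)
qed

text \<open>
  An independent list of maximal length spans everything, since otherwise it could be extended.
\<close>

lemma (in ring) finite_dimension_if_independent_bounded:
  assumes "\<And>Us. independent K Us \<Longrightarrow> length Us \<le> n" "subring K R"
  shows "finite_dimension K (carrier R)"
proof -
  obtain Us where Us: "independent K Us" "\<And>Vs. independent K Vs \<Longrightarrow> length Vs \<le> length Us"
    using ex_has_greatest_nat[of "independent K" "[]" length "Suc n"] assms(1)
    by (auto simp: less_Suc_eq_le)
  have "carrier R \<subseteq> Span K Us"
  proof
    fix u assume "u \<in> carrier R"
    thus "u \<in> Span K Us" using Us(2)[OF li_Cons[OF _ _ Us(1)], of u] by auto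
  qed
  hence "Span K Us = carrier R"
    using Span_in_carrier[OF subringE(1)[OF assms(2)] independent_in_carrier[OF Us(1)]] by blast
  thus ?thesis using dimension_independent[OF Us(1)] finite_dimensionI by metis
qed

context valued_field
begin

lemma nat_in_integer_ring: "[(n::nat)] \<cdot> \<one> \<in> \<O>"
proof (induction n)
  case (Suc n)
  thus ?case
    using subringE(7)[OF subring_integer_ring Suc subringE(3)[OF subring_integer_ring]] by simp
qed (simp add: integer_ring_def)

lemma residue_nat: "residue ([(n::nat)] \<cdot> \<one>) = [n] \<cdot>\<^bsub>\<kappa>\<^esub> \<one>\<^bsub>\<kappa>\<^esub>"
proof -
  interpret \<kappa>: field \<kappa> by (rule field_residue_field)
  show ?thesis
  proof (induction n)
    case (Suc n)
    thus ?case
      using residue_simps(2)[OF nat_in_integer_ring subringE(3)[OF subring_integer_ring], of n]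
      by (simp add: residue_one)
  qed (simp add: residue_zero)
qed

lemma combine_in_integer_ring:
  "set cs \<subseteq> \<O> \<Longrightarrow> set us \<subseteq> \<O> \<Longrightarrow> combine cs us \<in> \<O>"
  by (induction cs us rule: combine.induct)
     (auto simp: subringE(2,6,7)[OF subring_integer_ring])

lemma residue_combine:
  "set cs \<subseteq> \<O> \<Longrightarrow> set us \<subseteq> \<O> \<Longrightarrow>
     residue (combine cs us) = ring.combine \<kappa> (map residue cs) (map residue us)"
proof -
  interpret \<kappa>: field \<kappa> by (rule field_residue_field)
  show "set cs \<subseteq> \<O> \<Longrightarrow> set us \<subseteq> \<O> \<Longrightarrow> ?thesis"
    by (induction cs us rule: combine.induct)
       (auto simp: residue_simps residue_zero subringE(6)[OF subring_integer_ring]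
          combine_in_integer_ring)
qed

text \<open>
  Divide a relation over \<open>K\<close> by a nonzero coefficient of least valuation. All coefficients become
  integral and one becomes 1. By assumption \<open>near\<close> they reduce into the prime field, so the
  reduced relation contradicts the independence of the residues.
\<close>

lemma independent_lift:
  assumes K: "subfield K F"
    and near: "\<And>c. c \<in> K \<Longrightarrow> 0 \<le> v c \<Longrightarrow> \<exists>n::nat. 0 < v (c \<ominus> [n] \<cdot> \<one>)"
    and us: "set us \<subseteq> \<O>"
    and indep: "ring.independent \<kappa> (generate_field \<kappa> {}) (map residue us)"
  shows "independent K us"
proof (rule trivial_combine_imp_independent[OF K])
  interpret \<kappa>: field \<kappa> by (rule field_residue_field)
  have O_sub: "\<O> \<subseteq> carrier F" by (auto simp: integer_ring_def)
  show usF: "set us \<subseteq> carrier F" using us O_sub by blast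
  fix cs assume cs: "set cs \<subseteq> K" and comb: "combine cs us = \<zero>"
  have KF: "K \<subseteq> carrier F" using subfieldE(3)[OF K] .
  define ds where "ds = take (length us) cs"
  have ds: "set ds \<subseteq> K" using cs set_take_subset[of "length us" cs] by (auto simp: ds_def)
  have comb_ds: "combine ds us = \<zero>"
    using combine_take comb by (simp add: ds_def)
  show "set (take (length us) cs) \<subseteq> {\<zero>}"
  proof (rule ccontr)
    assume "\<not> set (take (length us) cs) \<subseteq> {\<zero>}"
    then obtain d where d: "d \<in> set ds" "d \<noteq> \<zero>" by (auto simp: ds_def)
    obtain c where c: "c \<in> set ds" "\<And>d. d \<in> set ds \<Longrightarrow> v c \<le> v d"
      using ex_min_if_finite[of "v ` set ds"] d by (force simp: not_less)
    have cF: "c \<in> carrier F" using c ds KF by blast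
    have "v d \<noteq> \<infinity>" using d ds KF val_inf_iff by blast
    hence c0: "c \<noteq> \<zero>" using c(2)[OF d(1)] by auto
    obtain r where r: "v c = ereal r" using val_real[OF cF c0] by blast
    have ic: "inv c \<in> K" using subfield_m_inv(1)[OF K] c ds c0 by blast
    define es where "es = map (\<lambda>x. inv c \<otimes> x) ds"
    have esK: "set es \<subseteq> K"
      using ic ds subringE(6)[OF subfieldE(1)[OF K]] by (auto simp: es_def)
    have esO: "set es \<subseteq> \<O>"
    proof -
      have "0 \<le> v (inv c \<otimes> x)" if x: "x \<in> set ds" for x
      proof -
        have "v (inv c \<otimes> x) = - ereal r + v x"
          using x ds KF val_mult[of "inv c" x] val_inv[OF cF c0] r by auto
        thus ?thesis using c(2)[OF x] r by (cases "v x") auto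
      qed
      thus ?thesis using esK KF by (auto simp: es_def integer_ring_def)
    qed
    have "combine es us = inv c \<otimes> combine ds us"
      unfolding es_def using ds KF usF ic by (intro combine_r_distr[symmetric]) auto
    hence "combine es us = \<zero>" using comb_ds ic KF by auto
    hence zero: "\<kappa>.combine (map residue es) (map residue us) = \<zero>\<^bsub>\<kappa>\<^esub>"
      using residue_combine[OF esO us] residue_zero by simp
    have P: "set (map residue es) \<subseteq> generate_field \<kappa> {}"
    proof -
      have "residue x \<in> generate_field \<kappa> {}" if x: "x \<in> set es" for x
      proof -
        have xO: "x \<in> \<O>" using x esO by blast
        then obtain n :: nat where n: "0 < v (x \<ominus> [n] \<cdot> \<one>)"
          using near[of x] x esK by (auto simp: integer_ring_def)
        hence "residue x = residue ([n] \<cdot> \<one>)"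
          using residue_eq_iff[OF xO nat_in_integer_ring, of n] xO
          by (auto simp: max_ideal_def integer_ring_def)
        thus ?thesis by (simp add: residue_nat \<kappa>.multiples_of_one_in_prime_field)
      qed
      thus ?thesis by auto
    qed
    have sf: "subfield (generate_field \<kappa> {}) \<kappa>"
      by (rule \<kappa>.generate_field_is_subfield) simp
    have "length es \<le> length us" by (simp add: es_def ds_def)
    hence "set (map residue es) \<subseteq> {\<zero>\<^bsub>\<kappa>\<^esub>}"
      using \<kappa>.independent_imp_trivial_combine[OF sf indep P zero] by simp
    moreover have "\<one> \<in> set es"
      using c(1) cF c0 by (auto simp: es_def field_Units intro!: image_eqI[of _ _ c])
    ultimately show False using residue_one by force
  qed
qed

text \<open>
  Since \<open>residue_degree\<close> is a definite description, it means something only once the residue field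
  is known to have finite dimension over the prime field; \<open>independent_lift\<close> bounds that dimension by
  the dimension of \<open>F\<close> over \<open>K\<close>.
\<close>

proposition card_residue_field_le:
  assumes "Factorial_Ring.prime p" "0 < v ([p] \<cdot> \<one>)"
    and K: "subfield K F" and fin: "finite_dimension K (carrier F)"
    and near: "\<And>c. c \<in> K \<Longrightarrow> 0 \<le> v c \<Longrightarrow> \<exists>n::nat. 0 < v (c \<ominus> [n] \<cdot> \<one>)"
  shows "finite (carrier \<kappa>) \<and> card (carrier \<kappa>) \<le> p ^ residue_degree F v"
proof -
  interpret \<kappa>: field \<kappa> by (rule field_residue_field)
  let ?P = "generate_field \<kappa> {}"
  have sf: "subfield ?P \<kappa>"
    by (rule \<kappa>.generate_field_is_subfield) simp
  have "[p] \<cdot> \<one> \<in> \<mm>" using assms(2) by (simp add: max_ideal_def)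
  hence "[p] \<cdot>\<^bsub>\<kappa>\<^esub> \<one>\<^bsub>\<kappa>\<^esub> = \<zero>\<^bsub>\<kappa>\<^esub>"
    using residue_eq_zero_iff[OF nat_in_integer_ring] residue_nat by metis
  note P = \<kappa>.prime_field_subset_multiples_of_one[OF assms(1) this]
  have finP: "finite ?P" using P by (rule finite_subset) simp
  have cardP: "card ?P \<le> p"
    using surj_card_le[OF _ P] by simp
  obtain n where n: "dimension n K (carrier F)" using fin by blast
  have "length Us \<le> n" if Us: "\<kappa>.independent ?P Us" for Us
  proof -
    have "set Us \<subseteq> residue ` \<O>"
      using \<kappa>.independent_in_carrier[OF Us] carrier_residue_field by simp
    moreover define g where "g = inv_into \<O> residue"
    ultimately have g: "g w \<in> \<O>" "residue (g w) = w" if "w \<in> set Us" for w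
      using that inv_into_into[of w residue \<O>] f_inv_into_f[of w residue \<O>] by auto
    define us where "us = map g Us"
    have us: "set us \<subseteq> \<O>" "Us = map residue us"
      using g by (auto simp: us_def comp_def map_idI)
    have "independent K us" using independent_lift[OF K near us(1)] Us us(2) by simp
    thus ?thesis
      using independent_length_le_dimension[OF K n] us by (auto simp: integer_ring_def)
  qed
  hence "\<kappa>.finite_dimension ?P (carrier \<kappa>)"
    using \<kappa>.finite_dimension_if_independent_bounded subfieldE(1)[OF sf] by blast
  hence "\<kappa>.dimension (residue_degree F v) ?P (carrier \<kappa>)"
    using \<kappa>.finite_dimensionE[OF sf] by (simp add: residue_degree_def over_def)
  hence "finite (carrier \<kappa>)" "card (carrier \<kappa>) \<le> card ?P ^ residue_degree F v"
    using \<kappa>.card_le_of_dimension finP by blast+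
  thus ?thesis using power_mono[OF cardP, of "residue_degree F v"] by simp
qed

end

section \<open>Polynomials with derivative zero on the residue field\<close>

context valued_field
begin

lemma max_ideal_mult_right: "x \<in> \<mm> \<Longrightarrow> y \<in> \<O> \<Longrightarrow> x \<otimes> y \<in> \<mm>"
  using max_ideal_mult[of y x] m_comm[of x y] by (simp add: integer_ring_def max_ideal_def)

lemma pow_in_integer_ring: "x \<in> \<O> \<Longrightarrow> x [^] (n::nat) \<in> \<O>"
  by (induction n) (simp_all add: subringE(3,6)[OF subring_integer_ring])

text \<open>
  The first-order Taylor expansion of a power, with the derivative written out and the remainder
  divided by the increment \<open>h\<close>. Using the exponent \<open>Suc n\<close> avoids the truncated exponent \<open>n - 1\<close>
  of the derivative.
\<close>

lemma power_perturb:
  assumes y: "y \<in> \<O>" and h: "h \<in> \<mm>"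
  shows "\<exists>r\<in>\<mm>. (y \<oplus> h) [^] Suc n = y [^] Suc n \<oplus> h \<otimes> ([Suc n] \<cdot> (y [^] n) \<oplus> r)"
proof (induction n)
  case 0
  have "\<zero> \<in> \<mm>" by (simp add: max_ideal_def)
  moreover have "y \<in> carrier F" "h \<in> carrier F"
    using y h by (auto simp: integer_ring_def max_ideal_def)
  ultimately show ?case by (intro bexI[of _ \<zero>]) simp_all
next
  case (Suc n)
  then obtain r where r: "r \<in> \<mm>"
    "(y \<oplus> h) [^] Suc n = y [^] Suc n \<oplus> h \<otimes> ([Suc n] \<cdot> (y [^] n) \<oplus> r)" by blast
  define w where "w = y [^] n"
  define t where "t = [Suc n] \<cdot> w"
  have c: "y \<in> carrier F" "h \<in> carrier F" "r \<in> carrier F" "w \<in> carrier F" "t \<in> carrier F"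
    using y h r by (auto simp: integer_ring_def max_ideal_def w_def t_def)
  have wO: "w \<in> \<O>" using pow_in_integer_ring[OF y] by (simp add: w_def)
  have "t = [Suc n] \<cdot> \<one> \<otimes> w"
    using c add_pow_ldistr[of \<one> w "Suc n"] by (simp add: t_def del: add.nat_pow_Suc)
  hence tO: "t \<in> \<O>"
    using subringE(6)[OF subring_integer_ring nat_in_integer_ring wO, of "Suc n"] by simp
  have T: "[Suc (Suc n)] \<cdot> (y [^] Suc n) = t \<otimes> y \<oplus> w \<otimes> y"
    using c add_pow_ldistr[of w y "Suc n"] add.nat_pow_Suc[of "Suc n" "w \<otimes> y"]
    by (simp add: t_def w_def del: add.nat_pow_Suc)
  let ?r = "r \<otimes> y \<oplus> h \<otimes> (t \<oplus> r)"
  have "?r \<in> \<mm>"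
    using max_ideal_subset subringE(7)[OF subring_integer_ring tO]
    by (intro max_ideal_add max_ideal_mult_right r(1) y h) (use r(1) in auto)
  moreover have "(y \<oplus> h) [^] Suc (Suc n) = y [^] Suc (Suc n) \<oplus>
                   h \<otimes> ([Suc (Suc n)] \<cdot> (y [^] Suc n) \<oplus> ?r)"
  proof -
    have "(y \<oplus> h) [^] Suc (Suc n) = (w \<otimes> y \<oplus> h \<otimes> (t \<oplus> r)) \<otimes> (y \<oplus> h)"
      unfolding nat_pow_Suc[of _ "Suc n"] r(2) by (simp add: w_def t_def)
    also have "\<dots> = w \<otimes> y \<otimes> y \<oplus> h \<otimes> ((t \<otimes> y \<oplus> w \<otimes> y) \<oplus> ?r)"
      using c by algebra
    finally show ?thesis unfolding T by (simp add: w_def)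
  qed
  ultimately show ?case by blast
qed

text \<open>
  The factor of \<open>h\<close> in the expansion of the monomial is its derivative up to an element of \<open>\<mm>\<close>,
  and the derivative lies in \<open>\<mm>\<close> either because \<open>a\<close> does or because the exponent is a multiple of \<open>p\<close>.
\<close>

lemma monomial_perturb:
  fixes p n :: nat
  assumes a: "a \<in> \<O>" and y: "y \<in> \<O>" and h: "h \<in> \<mm>"
    and vp: "0 < v ([p] \<cdot> \<one>)" and small: "a \<in> \<mm> \<or> p dvd n"
  shows "\<exists>s\<in>\<mm>. a \<otimes> (y \<oplus> h) [^] n = a \<otimes> y [^] n \<oplus> h \<otimes> s"
proof (cases n)
  case 0
  have "\<zero> \<in> \<mm>" by (simp add: max_ideal_def)
  thus ?thesis using 0 a h by (intro bexI[of _ \<zero>]) (auto simp: integer_ring_def max_ideal_def)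
next
  case (Suc m)
  obtain r where r: "r \<in> \<mm>"
    "(y \<oplus> h) [^] n = y [^] n \<oplus> h \<otimes> ([n] \<cdot> (y [^] m) \<oplus> r)"
    using power_perturb[OF y h, of m] Suc by blast
  define t where "t = [n] \<cdot> (y [^] m)"
  have c: "a \<in> carrier F" "y \<in> carrier F" "h \<in> carrier F" "r \<in> carrier F" "t \<in> carrier F"
    using a y h r by (auto simp: integer_ring_def max_ideal_def t_def)
  have yO: "y [^] m \<in> \<O>" by (rule pow_in_integer_ring[OF y])
  have t: "t = [n] \<cdot> \<one> \<otimes> y [^] m" using c by (simp add: t_def add_pow_ldistr)
  hence tO: "t \<in> \<O>"
    using subringE(6)[OF subring_integer_ring nat_in_integer_ring yO] by simp
  have "a \<otimes> (t \<oplus> r) \<in> \<mm>"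
  proof (cases "p dvd n")
    case True
    then obtain i where i: "n = p * i" by blast
    have "[p] \<cdot> \<one> \<in> \<mm>" using vp by (simp add: max_ideal_def)
    moreover have "[n] \<cdot> \<one> = [p] \<cdot> \<one> \<otimes> [i] \<cdot> \<one>"
      by (simp add: i add_pow_ldistr add.nat_pow_pow mult.commute)
    ultimately have "t \<in> \<mm>"
      using yO nat_in_integer_ring by (simp add: t max_ideal_mult_right)
    thus ?thesis using a r(1) by (intro max_ideal_mult max_ideal_add)
  next
    case False
    hence "a \<in> \<mm>" using small by blast
    thus ?thesis
      using max_ideal_subset subringE(7)[OF subring_integer_ring tO] r(1)
      by (intro max_ideal_mult_right) auto
  qed
  moreover have "a \<otimes> (y \<oplus> h) [^] n = a \<otimes> y [^] n \<oplus> h \<otimes> (a \<otimes> (t \<oplus> r))"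
  proof -
    have "y [^] n \<in> carrier F" using c by simp
    thus ?thesis unfolding r(2) t_def[symmetric] using c by algebra
  qed
  ultimately show ?thesis by blast
qed

lemma eval_in_integer_ring: "set q \<subseteq> \<O> \<Longrightarrow> x \<in> \<O> \<Longrightarrow> eval q x \<in> \<O>"
  by (induction q) (auto simp: subringE(2,6,7)[OF subring_integer_ring] pow_in_integer_ring)

lemma eval_perturb:
  fixes p :: nat
  assumes "set q \<subseteq> \<O>" and y: "y \<in> \<O>" and h: "h \<in> \<mm>" and vp: "0 < v ([p] \<cdot> \<one>)"
    and "\<And>i. i < length q \<Longrightarrow> \<not> p dvd i \<Longrightarrow> 0 < v (coeff q i)"
  shows "\<exists>s\<in>\<mm>. eval q (y \<oplus> h) = eval q y \<oplus> h \<otimes> s"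
  using assms(1,5)
proof (induction q)
  case Nil
  have "\<zero> \<in> \<mm>" by (simp add: max_ideal_def)
  thus ?case using h by (intro bexI[of _ \<zero>]) (auto simp: max_ideal_def)
next
  case (Cons a q)
  have aO: "a \<in> \<O>" and qO: "set q \<subseteq> \<O>" using Cons.prems(1) by auto
  have "0 < v (coeff q i)" if "i < length q" "\<not> p dvd i" for i
    using Cons.prems(2)[of i] that by simp
  then obtain s where s: "s \<in> \<mm>" "eval q (y \<oplus> h) = eval q y \<oplus> h \<otimes> s"
    using Cons.IH[OF qO] by blast
  have "a \<in> \<mm> \<or> p dvd length q"
    using Cons.prems(2)[of "length q"] aO by (auto simp: max_ideal_def integer_ring_def)
  then obtain u where u: "u \<in> \<mm>"
    "a \<otimes> (y \<oplus> h) [^] length q = a \<otimes> y [^] length q \<oplus> h \<otimes> u"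
    using monomial_perturb[OF aO y h vp] by blast
  define z where "z = eval q y"
  have "z \<in> carrier F" "a \<in> carrier F" "y [^] length q \<in> carrier F"
      "h \<in> carrier F" "u \<in> carrier F" "s \<in> carrier F"
    using eval_in_integer_ring[OF qO y] aO y h u s
    by (auto simp: integer_ring_def max_ideal_def z_def)
  hence "(a \<otimes> y [^] length q \<oplus> h \<otimes> u) \<oplus> (z \<oplus> h \<otimes> s) =
         (a \<otimes> y [^] length q \<oplus> z) \<oplus> h \<otimes> (u \<oplus> s)"
    by algebra
  hence "eval (a # q) (y \<oplus> h) = eval (a # q) y \<oplus> h \<otimes> (u \<oplus> s)"
    using s(2) u(2) by (simp add: z_def)
  thus ?case using max_ideal_add[OF u(1) s(1)] by blast
qed

text \<open>
  The increment \<open>x \<ominus> y\<close> is multiplied by a factor from \<open>\<mm>\<close>. The inequality is strict only for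
  \<open>x \<noteq> y\<close>, because two equal points have difference of infinite valuation.
\<close>

lemma eval_contracts:
  fixes p :: nat
  assumes "set q \<subseteq> \<O>" "0 < v ([p] \<cdot> \<one>)"
    "\<And>i. i < length q \<Longrightarrow> \<not> p dvd i \<Longrightarrow> 0 < v (coeff q i)"
    and x: "x \<in> \<O>" and y: "y \<in> \<O>" and close: "x \<ominus> y \<in> \<mm>"
  shows "eval q x \<ominus> eval q y \<in> \<mm>"
    and "v (x \<ominus> y) \<le> v (eval q x \<ominus> eval q y)"
    and "x \<noteq> y \<Longrightarrow> v (x \<ominus> y) < v (eval q x \<ominus> eval q y)"
proof -
  let ?h = "x \<ominus> y"
  have c: "x \<in> carrier F" "y \<in> carrier F" using x y by (auto simp: integer_ring_def)
  have xy: "y \<oplus> ?h = x" using c by algebra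
  obtain s where s: "s \<in> \<mm>" "eval q x = eval q y \<oplus> ?h \<otimes> s"
    using eval_perturb[OF assms(1) y close assms(2,3)] unfolding xy by blast
  have sc: "s \<in> carrier F" "eval q y \<in> carrier F" "?h \<in> carrier F"
    using s c eval_in_integer_ring[OF assms(1) y] by (auto simp: max_ideal_def integer_ring_def)
  hence eq: "eval q x \<ominus> eval q y = ?h \<otimes> s" unfolding s(2) by algebra
  show "eval q x \<ominus> eval q y \<in> \<mm>"
    unfolding eq using max_ideal_mult_right[OF close] s(1) max_ideal_subset by blast
  have vs: "0 < v s" using s(1) by (simp add: max_ideal_def)
  have veq: "v (eval q x \<ominus> eval q y) = v ?h + v s" unfolding eq using sc by (simp add: val_mult)
  show "v ?h \<le> v (eval q x \<ominus> eval q y)"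
    unfolding veq using vs by (cases "v ?h"; cases "v s") auto
  assume "x \<noteq> y"
  hence "?h \<noteq> \<zero>" using c by simp
  then obtain r where "v ?h = ereal r" using val_real[OF sc(3)] by blast
  thus "v ?h < v (eval q x \<ominus> eval q y)"
    unfolding veq using vs by (cases "v s") auto
qed

lemma val_pow_decreasing:
  assumes "x \<in> carrier F" "v x < 0"
  shows "v (x [^] Suc n) < v (x [^] n)"
proof -
  have x0: "x \<noteq> \<zero>" using assms by auto
  then obtain r where r: "v x = ereal r" using val_real assms by blast
  have "x [^] n \<noteq> \<zero>"
    using x0 assms(1) by (induction n) (auto simp: integral_iff)
  then obtain s where "v (x [^] n) = ereal s" using val_real assms(1) by blast
  thus ?thesis using assms r by (simp add: val_mult)
qed

text \<open>
  For \<open>x\<close> outside the integers, the powers of \<open>x\<close> have decreasing valuation, so a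
  polynomial with integral coefficients is dominated by the next power of \<open>x\<close>.
\<close>

lemma val_eval_gt:
  assumes "set q \<subseteq> \<O>" "x \<in> carrier F" "v x < 0"
  shows "eval q x \<in> carrier F \<and> v (x [^] length q) < v (eval q x)"
  using assms(1)
proof (induction q)
  case Nil
  thus ?case by simp
next
  case (Cons a q)
  have IH: "eval q x \<in> carrier F" "v (x [^] length q) < v (eval q x)"
    and a: "a \<in> carrier F" "0 \<le> v a"
    using Cons by (auto simp: integer_ring_def)
  have "v (x [^] length q) \<le> v (a \<otimes> x [^] length q)"
    using a assms(2) by (simp add: val_mult add_increasing)
  hence "v (x [^] length q) \<le> v (eval (a # q) x)"
    using val_add[of "a \<otimes> x [^] length q" "eval q x"] a assms(2) IH
    by (auto simp: min_le_iff_disj intro: order_trans)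
  thus ?case
    using val_pow_decreasing[OF assms(2,3), of "length q"] a assms(2) IH by auto
qed

text \<open>
  With a unit as leading coefficient the value has the valuation of the leading power of \<open>x\<close>, which
  for degree at least 2 lies strictly below that of \<open>x\<close>.
\<close>

lemma eval_escapes:
  assumes "set (a # q) \<subseteq> \<O>" "v a = 0" "2 \<le> length q" "x \<in> carrier F" "v x < 0"
  shows "eval (a # q) x \<in> carrier F \<and> v (eval (a # q) x) < v x"
proof -
  let ?m = "a \<otimes> x [^] length q" and ?e = "eval q x"
  have a: "a \<in> carrier F" using assms(1) by (simp add: integer_ring_def)
  have e: "?e \<in> carrier F" "v (x [^] length q) < v ?e"
    using val_eval_gt[of q x] assms by auto
  have vm: "v ?m = v (x [^] length q)" using assms a by (simp add: val_mult)
  have lt: "v (x [^] length q) < v x"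
  proof -
    have "v (x [^] Suc (Suc n)) < v x" for n
    proof (induction n)
      case 0
      show ?case using val_pow_decreasing[OF assms(4,5), of 1] assms(4) by simp
    next
      case (Suc n)
      thus ?case using val_pow_decreasing[OF assms(4,5), of "Suc (Suc n)"] by (rule order_less_trans[rotated])
    qed
    moreover obtain n where "length q = Suc (Suc n)"
      using assms(3) by (metis add_2_eq_Suc le_Suc_ex)
    ultimately show ?thesis by metis
  qed
  have "v (?m \<oplus> ?e) < v x"
  proof (rule ccontr)
    assume "\<not> v (?m \<oplus> ?e) < v x"
    hence "v ?m < v (?m \<oplus> ?e)" using lt vm by auto
    moreover have "?m = (?m \<oplus> ?e) \<ominus> ?e"
    proof -
      have "?m \<in> carrier F" using a assms(4) by simp
      thus ?thesis using e(1) by algebra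
    qed
    ultimately show False
      using val_diff[of "?m \<oplus> ?e" ?e] e a assms(4) vm by (auto simp: min_le_iff_disj)
  qed
  thus ?thesis using a e assms(4) by simp
qed

lemma periodic_points_in_integer_ring:
  assumes "set (a # q) \<subseteq> \<O>" "v a = 0" "2 \<le> length q"
  shows "periodic_points (eval (a # q)) (carrier F) \<subseteq> \<O>"
proof
  fix x assume "x \<in> periodic_points (eval (a # q)) (carrier F)"
  then obtain n where x: "x \<in> carrier F" and n: "n > 0" "(eval (a # q) ^^ n) x = x"
    by (auto simp: periodic_points_def)
  show "x \<in> \<O>"
  proof (rule ccontr)
    assume "x \<notin> \<O>"
    hence neg: "v x < 0" using x by (simp add: integer_ring_def)
    have "(eval (a # q) ^^ Suc m) x \<in> carrier F \<and> v ((eval (a # q) ^^ Suc m) x) < v x" for m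
    proof (induction m)
      case 0
      show ?case using eval_escapes[OF assms x neg] by simp
    next
      case (Suc m)
      thus ?case using eval_escapes[OF assms, of "(eval (a # q) ^^ Suc m) x"] neg
        by (auto simp del: eval.simps intro: order_less_trans)
    qed
    from this[of "n - 1"] show False using n by simp
  qed
qed

text \<open>
  The product of the two periods is a common period. Two distinct points of one residue class would
  be strictly closer after it than at the start, although both have returned.
\<close>

lemma periodic_points_separated:
  fixes p :: nat
  assumes q: "set q \<subseteq> \<O>" "0 < v ([p] \<cdot> \<one>)"
    "\<And>i. i < length q \<Longrightarrow> \<not> p dvd i \<Longrightarrow> 0 < v (coeff q i)"
    and x: "x \<in> \<O>" "x \<in> periodic_points (eval q) S"
    and y: "y \<in> \<O>" "y \<in> periodic_points (eval q) S"
    and close: "x \<ominus> y \<in> \<mm>"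
  shows "x = y"
proof (rule ccontr)
  assume ne: "x \<noteq> y"
  let ?g = "eval q"
  have iter: "(?g ^^ n) x \<in> \<O> \<and> (?g ^^ n) y \<in> \<O> \<and> (?g ^^ n) x \<ominus> (?g ^^ n) y \<in> \<mm> \<and>
      (n > 0 \<longrightarrow> v (x \<ominus> y) < v ((?g ^^ n) x \<ominus> (?g ^^ n) y))" for n
  proof (induction n)
    case 0
    show ?case using x y close by simp
  next
    case (Suc n)
    let ?x = "(?g ^^ n) x" and ?y = "(?g ^^ n) y"
    \<comment> \<open>The first step is strict since \<open>x \<noteq> y\<close>; later steps need only the weak inequality, so it does not
      matter whether the orbits meet.\<close>
    have "v (x \<ominus> y) < v (?g ?x \<ominus> ?g ?y)"
      using Suc eval_contracts(2,3)[OF q, of ?x ?y] ne by (cases "n = 0") auto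
    thus ?case
      using Suc eval_contracts(1)[OF q, of ?x ?y] eval_in_integer_ring[OF q(1)] by simp
  qed
  obtain n m where nm: "n > 0" "(?g ^^ n) x = x" "m > 0" "(?g ^^ m) y = y"
    using x y by (auto simp: periodic_points_def)
  have fixed: "(f ^^ (k * l)) z = z" if "(f ^^ l) z = z" for f :: "'a \<Rightarrow> 'a" and k l z
    using that by (induction k) (simp_all add: funpow_add)
  have "(?g ^^ (m * n)) x = x" "(?g ^^ (m * n)) y = y"
    using fixed[OF nm(2), of m] fixed[OF nm(4), of n] by (simp_all add: mult.commute)
  thus False using iter[of "m * n"] nm by simp
qed

end

section \<open>Finite extensions of the p-adic numbers\<close>

locale Qp_extension =
  fixes p :: nat and F :: "('a, 'b) ring_scheme" (structure)
    and \<iota> :: "(nat \<Rightarrow> rat) set \<Rightarrow> 'a" and v :: "'a \<Rightarrow> ereal"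
  assumes prime_p: "Factorial_Ring.prime p"
    and extension: "finite_Qp_extension p F \<iota>"
    and valuation: "Qp_extension_valuation p F \<iota> v"

sublocale Qp_extension \<subseteq> valued_field F v
proof -
  interpret field F using extension by (simp add: finite_Qp_extension_def)
  show "valued_field F v"
    by unfold_locales (use valuation in \<open>auto simp: Qp_extension_valuation_def\<close>)
qed

context Qp_extension
begin

abbreviation embed :: "(nat \<Rightarrow> rat) \<Rightarrow> 'a" where
  "embed s \<equiv> \<iota> (Qp_class p s)"

lemma embed_hom: "embed \<in> ring_hom (padic_cauchy_ring p) F"
  using ring_hom_trans[OF Qp_class_hom[OF prime_p], of \<iota> F] extension
  by (simp add: finite_Qp_extension_def comp_def)

lemma embed_closed: "padic_cauchy p s \<Longrightarrow> embed s \<in> carrier F"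
  using ring_hom_closed[OF embed_hom, of s] by (simp add: padic_cauchy_ring_def)

lemma embed_add:
  "padic_cauchy p s \<Longrightarrow> padic_cauchy p t \<Longrightarrow> embed (\<lambda>n. s n + t n) = embed s \<oplus> embed t"
  using ring_hom_add[OF embed_hom, of s t] by (simp add: padic_cauchy_ring_def)

lemma embed_nat: "embed (\<lambda>_. of_nat n) = [n] \<cdot> \<one>"
proof (induction n)
  case 0
  have "ring (padic_cauchy_ring p)"
    using cring_padic_cauchy_ring[OF prime_p] by (rule cring.axioms(1))
  thus ?case
    using ring_hom_zero[OF embed_hom _ ring_axioms] by (simp add: padic_cauchy_ring_def)
next
  case (Suc n)
  have "embed (\<lambda>_. 1) = \<one>"
    using ring_hom_one[OF embed_hom] by (simp add: padic_cauchy_ring_def)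
  thus ?case
    using embed_add[OF padic_cauchy_const[OF prime_p] padic_cauchy_const[OF prime_p],
        of "of_nat n" 1] Suc
    by (simp add: add.commute)
qed

lemma val_embed:
  obtains e :: real where "e > 0"
    "\<And>s. padic_cauchy p s \<Longrightarrow> v (embed s) = ereal e * Qp_val p (Qp_class p s)"
proof -
  obtain e :: real where "e > 0" "\<forall>x\<in>carrier (Qp p). v (\<iota> x) = ereal e * Qp_val p x"
    using valuation by (auto simp: Qp_extension_valuation_def)
  thus ?thesis using that[of e] by (simp add: carrier_Qp[OF prime_p])
qed

lemma val_p_pos: "0 < v ([p] \<cdot> \<one>)"
proof -
  obtain e :: real where e: "e > 0"
    "\<And>s. padic_cauchy p s \<Longrightarrow> v (embed s) = ereal e * Qp_val p (Qp_class p s)"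
    using val_embed by blast
  have "v ([p] \<cdot> \<one>) = ereal e"
    using e(2)[OF padic_cauchy_const[OF prime_p], of "of_nat p"]
    by (simp add: embed_nat Qp_val_class_const[OF prime_p] rat_pval_p[OF prime_p])
  thus ?thesis using e by simp
qed

lemma subfield_image: "subfield (\<iota> ` carrier (Qp p)) F"
proof (rule subfieldI')
  interpret C: cring "padic_cauchy_ring p" by (rule cring_padic_cauchy_ring[OF prime_p])
  have eq: "\<iota> ` carrier (Qp p) = embed ` carrier (padic_cauchy_ring p)"
    by (auto simp: carrier_Qp[OF prime_p] padic_cauchy_ring_def)
  have hr: "ring_hom_ring (padic_cauchy_ring p) F embed"
    by (rule ring_hom_ringI2[OF C.ring_axioms ring_axioms embed_hom])
  show "subring (\<iota> ` carrier (Qp p)) F"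
    unfolding eq by (rule ring_hom_ring.img_is_subring[OF hr C.carrier_is_subring])
  fix c assume c: "c \<in> \<iota> ` carrier (Qp p) - {\<zero>}"
  have hom: "\<iota> \<in> ring_hom (Qp p) F" using extension by (simp add: finite_Qp_extension_def)
  have "ring (Qp p)"
    unfolding Qp_def by (rule ideal.quotient_is_ring[OF ideal_padic_null[OF prime_p]])
  hence z: "\<iota> \<zero>\<^bsub>Qp p\<^esub> = \<zero>" by (rule ring_hom_zero[OF hom _ ring_axioms])
  obtain x where x: "x \<in> carrier (Qp p)" "c = \<iota> x" using c by blast
  have "x \<noteq> \<zero>\<^bsub>Qp p\<^esub>" using z c x by auto
  then obtain y where y: "y \<in> carrier (Qp p)" "x \<otimes>\<^bsub>Qp p\<^esub> y = \<one>\<^bsub>Qp p\<^esub>"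
    using Qp_inverse_exists[OF prime_p x(1)] by blast
  have "c \<otimes> \<iota> y = \<one>"
    using ring_hom_mult[OF hom x(1) y(1)] ring_hom_one[OF hom] x(2) y(2) by simp
  hence "inv c = \<iota> y"
    using x y ring_hom_closed[OF hom] by (intro comm_inv_char) auto
  thus "inv c \<in> \<iota> ` carrier (Qp p)" using y(1) by simp
qed

text \<open>
  Approximate the p-adic number by a rational one, which then is integral at \<open>p\<close>, and the
  rational by a natural number.
\<close>

lemma near_natural:
  assumes "c \<in> \<iota> ` carrier (Qp p)" "0 \<le> v c"
  shows "\<exists>n::nat. 0 < v (c \<ominus> [n] \<cdot> \<one>)"
proof -
  note const = padic_cauchy_const[OF prime_p]
  obtain e :: real where e: "e > 0"
    "\<And>s. padic_cauchy p s \<Longrightarrow> v (embed s) = ereal e * Qp_val p (Qp_class p s)"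
    using val_embed by blast
  obtain s where s: "padic_cauchy p s" "c = embed s"
    using assms(1) by (auto simp: carrier_Qp[OF prime_p])
  obtain q where q: "1 \<le> Qp_val p (Qp_class p (\<lambda>n. s n - q))"
    using Qp_class_near_rational[OF prime_p s(1)] by blast
  define u where "u = embed (\<lambda>n. s n - q)"
  have cu: "padic_cauchy p (\<lambda>n. s n - q)"
    using padic_cauchy_add[OF prime_p s(1) const, of "- q"] by simp
  have "0 < Qp_val p (Qp_class p (\<lambda>n. s n - q))" using q by (rule less_le_trans[rotated]) simp
  hence vu: "0 < v u" using e cu by (simp add: u_def ereal_zero_less_0_iff)
  define z where "z = embed (\<lambda>_. q)"
  have c_eq: "c = u \<oplus> z"
    using embed_add[OF cu const, of q] s(2) by (simp add: u_def z_def)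
  have closed: "u \<in> carrier F" "z \<in> carrier F" "c \<in> carrier F"
    using embed_closed[OF cu] embed_closed[OF const] embed_closed[OF s(1)] s(2)
    by (simp_all add: u_def z_def)
  hence "z = c \<ominus> u" unfolding c_eq by algebra
  hence "0 \<le> v z"
    using val_diff[OF closed(3,1)] assms(2) vu by (auto simp: min_le_iff_disj intro: order_trans)
  hence "0 \<le> rat_pval p q"
    using e(1) e(2)[OF const, of q]
    by (simp add: z_def Qp_val_class_const[OF prime_p] ereal_zero_le_0_iff)
  then obtain n :: nat where n: "0 < rat_pval p (q - of_nat n)"
    using rat_pval_nonneg_residue[OF prime_p] by blast
  define w where "w = embed (\<lambda>_. q - of_nat n)"
  have w: "w \<in> carrier F" "0 < v w"
    using embed_closed[OF const] e(1) e(2)[OF const] n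
    by (simp_all add: w_def Qp_val_class_const[OF prime_p] ereal_zero_less_0_iff)
  have "z = w \<oplus> [n] \<cdot> \<one>"
    using embed_add[OF const const, of "q - of_nat n" "of_nat n"] by (simp add: w_def z_def embed_nat)
  hence "c = u \<oplus> (w \<oplus> [n] \<cdot> \<one>)" using c_eq by simp
  moreover have "[n] \<cdot> \<one> \<in> carrier F" by simp
  ultimately have "c \<ominus> [n] \<cdot> \<one> = u \<oplus> w" using closed(1) w(1) by algebra
  moreover have "0 < v (u \<oplus> w)"
    using val_add[OF closed(1) w(1)] vu w(2) by (auto simp: min_le_iff_disj)
  ultimately have "0 < v (c \<ominus> [n] \<cdot> \<one>)" by simp
  thus ?thesis by blast
qed

lemma card_residue_field:
  "finite (carrier (residue_field F v)) \<and>
   card (carrier (residue_field F v)) \<le> p ^ residue_degree F v"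
  using card_residue_field_le[OF prime_p val_p_pos subfield_image _ near_natural] extension
  by (simp add: finite_Qp_extension_def)

end

section \<open>The bound on periodic points\<close>

theorem proposition2p1:
  fixes p d f :: nat
    and F :: "('a, 'b) ring_scheme"
    and \<iota> :: "(nat \<Rightarrow> rat) set \<Rightarrow> 'a"
    and v :: "'a \<Rightarrow> ereal"
    and \<phi> :: "'a list"
  assumes "Factorial_Ring.prime p"
    and "finite_Qp_extension p F \<iota>"
    and "Qp_extension_valuation p F \<iota> v"
    and "f = residue_degree F v"
    and "d > 0" and "p dvd d"
    and "\<phi> \<in> carrier (univ_poly F (integer_ring F v))" and "degree \<phi> = d"
    and "v (ring.coeff F \<phi> d) = 0"
    and "\<And>i. i \<le> d \<Longrightarrow> \<not> p dvd i \<Longrightarrow> v (ring.coeff F \<phi> i) > 0"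
  shows "finite (periodic_points (ring.eval F \<phi>) (carrier F)) \<and>
         card (periodic_points (ring.eval F \<phi>) (carrier F)) \<le> p ^ f"
proof -
  interpret Qp_extension p F \<iota> v using assms(1-3) by unfold_locales
  let ?P = "periodic_points (eval \<phi>) (carrier F)"
  have "\<phi> \<noteq> []" using assms(5,8) by auto
  then obtain a q where \<phi>: "\<phi> = a # q" by (cases \<phi>) auto
  have len: "length q = d" using assms(8) \<phi> by simp
  have coeffs: "set \<phi> \<subseteq> \<O>"
    using assms(7) \<open>\<phi> \<noteq> []\<close> by (simp add: univ_poly_def polynomial_def)
  have "v a = 0" using assms(9) \<phi> len by simp
  moreover have "2 \<le> length q"
    using dvd_imp_le[OF assms(6,5)] prime_ge_2_nat[OF assms(1)] len by simp
  ultimately have sub: "?P \<subseteq> \<O>"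
    using periodic_points_in_integer_ring[of a q] coeffs by (simp only: \<phi>)
  have vanish: "0 < v (coeff \<phi> i)" if "i < length \<phi>" "\<not> p dvd i" for i
    using assms(10)[of i] that len \<phi> by simp
  have inj: "inj_on residue ?P"
  proof (rule inj_onI)
    fix x y assume xy: "x \<in> ?P" "y \<in> ?P" "residue x = residue y"
    hence "x \<ominus>\<^bsub>F\<^esub> y \<in> \<mm>" using residue_eq_iff[of x y] sub by blast
    thus "x = y"
      using periodic_points_separated[OF coeffs val_p_pos vanish] xy sub by blast
  qed
  have img: "residue ` ?P \<subseteq> carrier \<kappa>"
    using sub by (auto simp: carrier_residue_field)
  have fin: "finite (carrier \<kappa>)" and le: "card (carrier \<kappa>) \<le> p ^ f"
    using card_residue_field assms(4) by auto
  have "finite ?P" using inj_on_finite[OF inj img fin] .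
  moreover have "card ?P \<le> p ^ f"
    using card_inj_on_le[OF inj img fin] le by simp
  ultimately show ?thesis by blast
qed

end
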